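(* Let $s\in(0,1)$ and, for $R>0$, let $B_R:=B(0,R)\subset\mathbb{R}^N$. For every fixed $r>1$ there exists a function $v\in C^2(B_1,\mathbb{R})\cap C(\mathbb{R}^N,\mathbb{R})$ with $\int_{\mathbb{R}^N}\frac{|v(x)|}{1+|x|^{N+2s}}\,dx<\infty$ such that $$\begin{cases}\mathcal{L}v=0 & \text{in }B_1,\\ \displaystyle\inf_{B_r\setminus B_1}v>0,\\ \displaystyle\min_{B_1}v<0.\end{cases}$$
   Context: $\mathcal{L}:=-\Delta+(-\Delta)^s$, where $(-\Delta)^s u(x)=c_{N,s}\,\mathrm{P.V.}\int_{\mathbb{R}^N}\frac{u(x)-u(y)}{|x-y|^{N+2s}}\,dy$ and $c_{N,s}=\Big(\int_{\mathbb{R}^N}\frac{1-\cos(\zeta_1)}{|\zeta|^{N+2s}}\,d\zeta\Big)^{-1}$. $B(0,R)$ is the open Euclidean ball of center $0$ and radius $R$. The equation $\mathcal{L}v=0$ in $B_1$ is understood pointwise. *)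

theory Defs
  imports "HOL-Analysis.Analysis"
begin

definition pderiv_dir :: "'a::euclidean_space \<Rightarrow> ('a \<Rightarrow> real) \<Rightarrow> 'a \<Rightarrow> real" where
  "pderiv_dir b f x = deriv (\<lambda>t. f (x + t *\<^sub>R b)) 0"

text \<open>The following two notions are meant for open \<open>S\<close>.\<close>

definition C1_on :: "'a::euclidean_space set \<Rightarrow> ('a \<Rightarrow> real) \<Rightarrow> bool" where
  "C1_on S f \<longleftrightarrow> continuous_on S f \<and>
     (\<forall>b\<in>Basis. (\<forall>x\<in>S. (\<lambda>t. f (x + t *\<^sub>R b)) field_differentiable (at 0)) \<and>
                continuous_on S (pderiv_dir b f))"

definition C2_on :: "'a::euclidean_space set \<Rightarrow> ('a \<Rightarrow> real) \<Rightarrow> bool" where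
  "C2_on S f \<longleftrightarrow> C1_on S f \<and> (\<forall>b\<in>Basis. C1_on S (pderiv_dir b f))"

definition laplacian :: "('a::euclidean_space \<Rightarrow> real) \<Rightarrow> 'a \<Rightarrow> real" where
  "laplacian f x = (\<Sum>b\<in>Basis. pderiv_dir b (pderiv_dir b f) x)"

text \<open>The index type of the coordinates carries no order, so the coordinate \<open>\<zeta>\<^sub>1\<close> is taken along
  an arbitrarily chosen standard basis vector; permuting the coordinates preserves both the norm
  and Lebesgue measure, so the constant does not depend on the choice.\<close>

definition frac_lap_const :: "'a::euclidean_space itself \<Rightarrow> real \<Rightarrow> real" where
  "frac_lap_const (_ :: 'a itself) s =
     inverse (LINT \<zeta>|(lborel :: 'a measure).
       (1 - cos (\<zeta> \<bullet> (SOME b. b \<in> Basis))) / norm \<zeta> powr (real DIM('a) + 2 * s))"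

definition frac_lap_integrand :: "real \<Rightarrow> ('a::euclidean_space \<Rightarrow> real) \<Rightarrow> 'a \<Rightarrow> 'a \<Rightarrow> real" where
  "frac_lap_integrand s u x y = (u x - u y) / norm (x - y) powr (real DIM('a) + 2 * s)"

text \<open>\<open>has_frac_lap s u x l\<close>: the principal value defining the fractional Laplacian of \<open>u\<close> at \<open>x\<close>
  exists as a finite limit of absolutely convergent integrals, and the operator has value \<open>l\<close>.
  The integrability clause excludes the default value 0 of divergent Bochner integrals.\<close>

definition has_frac_lap :: "real \<Rightarrow> ('a::euclidean_space \<Rightarrow> real) \<Rightarrow> 'a \<Rightarrow> real \<Rightarrow> bool" where
  "has_frac_lap s u x l \<longleftrightarrow>
     (\<forall>\<epsilon>>0. set_integrable lborel (- ball x \<epsilon>) (frac_lap_integrand s u x)) \<and>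
     ((\<lambda>\<epsilon>. frac_lap_const TYPE('a) s *
            (LINT y:(- ball x \<epsilon>)|lborel. frac_lap_integrand s u x y)) \<longlongrightarrow> l) (at_right 0)"

definition has_mixed_op :: "real \<Rightarrow> ('a::euclidean_space \<Rightarrow> real) \<Rightarrow> 'a \<Rightarrow> real \<Rightarrow> bool" where
  "has_mixed_op s u x l \<longleftrightarrow> (\<exists>m. has_frac_lap s u x m \<and> l = - laplacian u x + m)"

end

theory Submission
  imports Defs "HOL-Complex_Analysis.Complex_Analysis" "HOL-Real_Asymp.Real_Asymp"
begin

text \<open>
  The operator has a one-dimensional fundamental solution \<open>-F\<close> (up to a factor), where
  \<open>F t\<close> is the integral over \<open>x > 0\<close> of \<open>(1 - cos (t x)) / (x^2 + x^(2 s))\<close>: the profile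
  \<open>F (y \<bullet> b - q)\<close> is annihilated by the mixed operator off the hyperplane \<open>y \<bullet> b = q\<close>.
  Rotating the contour onto the imaginary axis writes \<open>F\<close> as the integral of
  \<open>(1 - exp (- t l)) \<mu> l / l^2\<close> with a positive weight \<open>\<mu>\<close>, so \<open>F\<close> is smooth and strictly concave on
  \<open>t > 0\<close>. Hence, for \<open>p > r\<close>, \<open>W y = 2 F p - F (p - y) - F (p + y)\<close> vanishes at \<open>0\<close> and is positive
  for \<open>0 < \<bar>y\<bar> < p\<close>. The sum of \<open>W\<close> over all coordinates solves the equation in the cube of
  half-width \<open>p\<close>, and its only zero there is the origin; subtracting half of its minimum over the
  closed annulus gives the required function.
\<close>

section \<open>Integrability from power bounds\<close>

text \<open>For \<open>x > 0\<close> the reciprocal symbol \<open>1 / (x^2 + x^(2 s))\<close> equals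
  \<open>x^(- 2 s) * \<phi> x\<close>. Formally, the fractional Laplacian multiplies the frequency
  by \<open>x^(2 s)\<close> and turns \<open>F\<close> into minus the cosine integral of
  \<open>\<phi>\<close>, while the second derivative multiplies by \<open>x^2\<close> and gives the
  cosine integral of \<open>1 - \<phi>\<close>: a point mass at 0 minus the same cosine integral.
  Hence the cancellation off 0. Rigorously, both terms are identified with \<open>- D 2\<close> at
  the distance from the hyperplane: the local one by differentiating the Laplace form of
  \<open>F\<close>, the nonlocal one by a second contour rotation. The obstacle is that for
  \<open>s \<ge> 1/2\<close> the cosine integral of \<open>\<phi>\<close> does not converge
  absolutely. It therefore never enters a Fubini argument untruncated: the ball removed in the
  principal value is converted into a frequency cutoff, and the limit is taken last. Profiles grow
  at most like the power \<open>s < 2 s\<close>, which makes all nonlocal integrals at infinity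
  finite. All coordinates are summed because in dimension at least 2 a single \<open>W\<close>
  vanishes on a hyperplane that meets the annulus.\<close>

lemma set_integrable_lborel_nonneg:
  fixes f :: "real \<Rightarrow> real"
  assumes "f integrable_on A" "\<And>x. x \<in> A \<Longrightarrow> 0 \<le> f x" "A \<in> sets borel" "f \<in> borel_measurable borel"
  shows "set_integrable lborel A f"
proof -
  have "set_integrable lebesgue A f"
    using nonnegative_absolutely_integrable_1[OF assms(1,2)] .
  then have "integrable (completion lborel) (\<lambda>x. indicator A x *\<^sub>R f x)"
    by (simp add: set_integrable_def)
  then show ?thesis
    unfolding set_integrable_def using assms(3,4) by (subst (asm) integrable_completion) auto
qed

lemma set_integrable_powr_bounds:
  fixes f :: "real \<Rightarrow> real"
  assumes [measurable]: "f \<in> borel_measurable borel" and "\<alpha> > -1" "\<beta> < -1"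
    and near: "\<And>x. 0 < x \<Longrightarrow> x \<le> 1 \<Longrightarrow> \<bar>f x\<bar> \<le> C * x powr \<alpha>"
    and far: "\<And>x. 1 \<le> x \<Longrightarrow> \<bar>f x\<bar> \<le> C * x powr \<beta>"
  shows "set_integrable lborel {0<..} f"
proof -
  have 1: "set_integrable lborel {0..1} (\<lambda>x::real. x powr \<alpha>)"
    using assms by (intro set_integrable_lborel_nonneg integrable_on_powr_from_0) auto
  have 2: "set_integrable lborel {1..} (\<lambda>x::real. x powr \<beta>)"
    using has_integral_powr_to_inf[of \<beta> 1] assms
    by (intro set_integrable_lborel_nonneg) (auto simp: integrable_on_def)
  let ?g = "\<lambda>x. C * (indicator {0..1} x *\<^sub>R (x powr \<alpha>)) + C * (indicator {1..} x *\<^sub>R (x powr \<beta>))"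
  have "0 \<le> C" using near[of 1] by auto
  have g: "integrable lborel ?g"
    using 1 2 unfolding set_integrable_def by auto
  show ?thesis
    unfolding set_integrable_def
  proof (rule Bochner_Integration.integrable_bound[OF g])
    show "AE x in lborel. norm (indicat_real {0<..} x *\<^sub>R f x) \<le> norm (?g x)"
    proof (intro AE_I2)
      fix x :: real
      have nn: "0 \<le> C * x powr \<alpha>" "0 \<le> C * x powr \<beta>" using \<open>0 \<le> C\<close> by auto
      show "norm (indicat_real {0<..} x *\<^sub>R f x) \<le> norm (?g x)"
        using near[of x] far[of x] nn by (cases "x \<le> 0"; cases "x < 1"; cases "x = 1") (auto simp: indicator_def)
    qed
  qed simp
qed

text \<open>Polar coordinates for radial functions, with no surface measure involved. Both sides
  agree on half-lines, the left by scaling of ball volumes and the right by the fundamental theorem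
  of calculus, and half-lines form an intersection-stable generator.\<close>

lemma distr_norm_lborel:
  "distr lborel borel (norm :: 'a::euclidean_space \<Rightarrow> real) =
     density lborel (\<lambda>r. ennreal (indicator {0..} r *
       (real DIM('a) * measure lborel (ball (0::'a) 1) * r ^ (DIM('a) - 1))))"
  (is "?M = ?N")
proof (rule measure_eqI_generator_eq[where E = "range atMost" and \<Omega> = UNIV and A = "\<lambda>n. {..real n}"])
  let ?w = "measure lborel (ball (0::'a) 1)"
  have M: "emeasure ?M {..a} = ennreal (if 0 \<le> a then ?w * a ^ DIM('a) else 0)" for a
  proof -
    have "emeasure ?M {..a} = emeasure lborel (cball (0::'a) a)"
      by (subst emeasure_distr) (auto intro!: arg_cong[where f = "emeasure lborel"])
    also have "\<dots> = ennreal (if 0 \<le> a then ?w * a ^ DIM('a) else 0)"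
    proof (cases "0 \<le> a")
      case True
      have "emeasure lborel (cball (0::'a) a) = ennreal (measure lborel (cball (0::'a) a))"
        using emeasure_lborel_cball_finite[of "0::'a" a] by (intro emeasure_eq_ennreal_measure) (auto simp: less_top)
      also have "measure lborel (cball (0::'a) a) = measure lborel (ball (0::'a) a)"
        by (simp add: content_cball_conv_ball)
      also have "\<dots> = a ^ DIM('a) * ?w"
        using content_ball_conv_unit_ball[OF True, of "0::'a"] by simp
      finally show ?thesis using True by (simp add: mult.commute)
    qed auto
    finally show ?thesis .
  qed
  have N: "emeasure ?N {..a} = ennreal (if 0 \<le> a then ?w * a ^ DIM('a) else 0)" for a
  proof -
    have "emeasure ?N {..a} = (\<integral>\<^sup>+r. ennreal (indicator {0..} r *
       (real DIM('a) * ?w * r ^ (DIM('a) - 1))) * indicator {..a} r \<partial>lborel)"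
      by (subst emeasure_density) auto
    also have "\<dots> = (\<integral>\<^sup>+r. ennreal (real DIM('a) * ?w * r ^ (DIM('a) - 1)) * indicator {0..a} r \<partial>lborel)"
      by (intro nn_integral_cong) (auto simp: indicator_def)
    also have "\<dots> = ennreal (if 0 \<le> a then ?w * a ^ DIM('a) else 0)"
    proof (cases "0 \<le> a")
      case True
      have "(\<integral>\<^sup>+r. ennreal (real DIM('a) * ?w * r ^ (DIM('a) - 1)) * indicator {0..a} r \<partial>lborel)
          = ennreal (?w * a ^ DIM('a) - ?w * 0 ^ DIM('a))"
        using True by (intro nn_integral_FTC_Icc) (auto intro!: derivative_eq_intros)
      then show ?thesis using True by simp
    qed (auto simp: indicator_def)
    finally show ?thesis .
  qed
  show "emeasure ?M X = emeasure ?N X" if "X \<in> range atMost" for X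
    using that M N by auto
  show "sets ?M = sigma_sets UNIV (range atMost)" "sets ?N = sigma_sets UNIV (range atMost)"
    by (auto simp: borel_eq_atMost)
  show "Int_stable (range (atMost :: real \<Rightarrow> real set))"
    by (auto simp: Int_stable_def)
  show "(\<Union>i. {..real i}) = UNIV"
    by (auto simp: real_arch_simple)
  show "emeasure ?M {..real i} \<noteq> \<infinity>" for i
    by (subst M) auto
qed auto

lemma integrable_norm_powr_bounds:
  fixes g :: "'a::euclidean_space \<Rightarrow> real"
  assumes [measurable]: "g \<in> borel_measurable borel" and "\<alpha> > -real DIM('a)" "\<beta> < -real DIM('a)"
    and near: "\<And>x. x \<noteq> 0 \<Longrightarrow> norm x \<le> 1 \<Longrightarrow> \<bar>g x\<bar> \<le> C * norm x powr \<alpha>"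
    and far: "\<And>x. 1 \<le> norm x \<Longrightarrow> \<bar>g x\<bar> \<le> C * norm x powr \<beta>"
  shows "integrable lborel g"
proof (rule integrableI_bounded)
  define D where "D = real DIM('a) * measure lborel (ball (0::'a) 1)"
  define h where "h r = (if r \<le> 1 then C * r powr \<alpha> else C * r powr \<beta>)" for r :: real
  have [measurable]: "h \<in> borel_measurable borel" unfolding h_def by measurable
  obtain b :: 'a where "b \<in> Basis" using nonempty_Basis by blast
  then have "norm b = 1" by auto
  then have C: "0 \<le> C" using far[of b] by auto
  have D: "0 \<le> D" by (simp add: D_def)
  have "(\<integral>\<^sup>+x. ennreal (norm (g x)) \<partial>lborel) \<le> (\<integral>\<^sup>+x. ennreal (h (norm (x::'a))) \<partial>lborel)"
  proof (rule nn_integral_mono_AE)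
    have "AE x in lborel. x \<noteq> (0::'a)" by (rule AE_lborel_singleton)
    then show "AE x in lborel. ennreal (norm (g x)) \<le> ennreal (h (norm (x::'a)))"
      by eventually_elim (use near far in \<open>auto intro!: ennreal_leI simp: h_def\<close>)
  qed
  also have "\<dots> = (\<integral>\<^sup>+r. ennreal (h r) \<partial>distr lborel borel (norm :: 'a \<Rightarrow> real))"
    by (subst nn_integral_distr) auto
  also have "\<dots> = (\<integral>\<^sup>+r. ennreal (indicator {0..} r * (D * r ^ (DIM('a) - 1))) * ennreal (h r) \<partial>lborel)"
    unfolding distr_norm_lborel D_def by (subst nn_integral_density) auto
  also have "\<dots> = (\<integral>\<^sup>+r. ennreal (norm (indicator {0<..} r *\<^sub>R (D * r ^ (DIM('a) - 1) * h r))) \<partial>lborel)"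
  proof (rule nn_integral_cong_AE)
    have "AE x in lborel. x \<noteq> (0::real)" by (rule AE_lborel_singleton)
    then show "AE r in lborel. ennreal (indicator {0..} r * (D * r ^ (DIM('a) - 1))) * ennreal (h r)
      = ennreal (norm (indicator {0<..} r *\<^sub>R (D * r ^ (DIM('a) - 1) * h r)))"
      by eventually_elim (use C D in \<open>auto simp: indicator_def h_def ennreal_mult[symmetric] abs_mult\<close>)
  qed
  also have "\<dots> < \<infinity>"
  proof -
    have pw: "r powr a * r ^ (DIM('a) - 1) = r powr (a + real DIM('a) - 1)" if "0 < r" for r a :: real
    proof -
      have "r ^ (DIM('a) - 1) = r powr (real DIM('a) - 1)"
        using that by (simp add: powr_realpow[symmetric] of_nat_diff DIM_positive Suc_le_eq)
      then show ?thesis by (simp add: powr_add[symmetric] add_diff_eq)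
    qed
    have "set_integrable lborel {0<..} (\<lambda>r. D * r ^ (DIM('a) - 1) * h r)"
    \<comment> \<open>The radial density contributes \<open>r ^ (DIM('a) - 1)\<close>, so the
      critical exponent \<open>- DIM('a)\<close> in space becomes the critical exponent
      \<open>-1\<close> on the half-line.\<close>
    proof (rule set_integrable_powr_bounds[where C = "D * C" and \<alpha> = "\<alpha> + real DIM('a) - 1" and \<beta> = "\<beta> + real DIM('a) - 1"])
      show "\<bar>D * r ^ (DIM('a) - 1) * h r\<bar> \<le> D * C * r powr (\<alpha> + real DIM('a) - 1)"
        if "0 < r" "r \<le> 1" for r
        using that C D by (simp add: h_def abs_mult pw[symmetric] mult_ac)
      show "\<bar>D * r ^ (DIM('a) - 1) * h r\<bar> \<le> D * C * r powr (\<beta> + real DIM('a) - 1)"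
        if "1 \<le> r" for r
        using that C D by (cases "r = 1") (simp_all add: h_def abs_mult pw[symmetric] mult_ac)
    qed (use assms in auto)
    then show ?thesis unfolding set_integrable_def integrable_iff_bounded by auto
  qed
  finally show "(\<integral>\<^sup>+x. ennreal (norm (g x)) \<partial>lborel) < \<infinity>" .
qed simp

section \<open>Rotating a contour across the quadrant\<close>

text \<open>Removing the vertex keeps the quadrant convex, so Cauchy's theorem for convex sets applies
  to functions that are singular at the origin.\<close>

definition quadrant :: "complex set" where
  "quadrant = {z. 0 \<le> Re z \<and> 0 \<le> Im z} - {0}"

text \<open>In the closed quadrant, \<open>z \<noteq> 0\<close> amounts to
  \<open>Re z + Im z > 0\<close>, a condition that survives convex combinations.\<close>

lemma convex_quadrant: "convex quadrant"
proof (rule convexI)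
  fix x y :: complex and u v :: real
  assume "x \<in> quadrant" "y \<in> quadrant" and uv: "0 \<le> u" "0 \<le> v" "u + v = 1"
  then have xy: "0 \<le> Re x" "0 \<le> Im x" "0 \<le> Re y" "0 \<le> Im y" "0 < Re x + Im x" "0 < Re y + Im y"
    by (auto simp: quadrant_def complex_eq_iff less_le add_nonneg_eq_0_iff)
  have "0 < u * (Re x + Im x) + v * (Re y + Im y)"
    using xy uv by (cases "u = 0") (auto intro!: add_pos_nonneg)
  then show "u *\<^sub>R x + v *\<^sub>R y \<in> quadrant"
    using xy uv by (auto simp: quadrant_def complex_eq_iff algebra_simps)
qed

lemma quadrant_line: "0 < R \<Longrightarrow> of_real R \<in> quadrant" "0 < R \<Longrightarrow> \<i> * of_real R \<in> quadrant"
  by (auto simp: quadrant_def complex_eq_iff)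

text \<open>Straight chords replace the usual quarter circles: they stay in the convex region, and
  since \<open>Re z + Im z = R\<close> along them, \<open>cmod z\<close> remains comparable to
  \<open>R\<close>.\<close>

lemma chord_bounds:
  assumes "0 < R" "z \<in> closed_segment (complex_of_real R) (\<i> * of_real R)"
  shows "z \<in> quadrant" "R / 2 \<le> cmod z" "cmod z \<le> R"
proof -
  show "z \<in> quadrant"
    using convex_contains_segment[of quadrant] convex_quadrant quadrant_line[OF assms(1)] assms(2) by blast
  obtain u where u: "0 \<le> u" "u \<le> 1" "z = (1 - u) *\<^sub>R complex_of_real R + u *\<^sub>R (\<i> * of_real R)"
    using assms(2) by (auto simp: closed_segment_def)
  have "R = Re z + Im z" unfolding u(3) by (simp add: algebra_simps)
  also have "\<dots> \<le> 2 * cmod z"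
    using complex_Re_le_cmod[of z] abs_Im_le_cmod[of z] by linarith
  finally show "R / 2 \<le> cmod z" by simp
  have "cmod z \<le> cmod ((1 - u) *\<^sub>R complex_of_real R) + cmod (u *\<^sub>R (\<i> * of_real R))"
    unfolding u(3) by (rule norm_triangle_ineq)
  also have "\<dots> = (1 - u) * R + u * R" using u(1,2) assms(1) by (simp add: norm_mult)
  also have "\<dots> = R" by (simp add: algebra_simps)
  finally show "cmod z \<le> R" .
qed

text \<open>Cauchy's theorem on the quadrilateral with vertices \<epsilon>, R, iR, i\<epsilon>. The
  factor \<i> in the second integral is the derivative of the parametrisation of the imaginary
  axis.\<close>

lemma contour_integral_quadrant:
  assumes f: "f holomorphic_on quadrant" and "0 < \<epsilon>" "\<epsilon> < R"
  defines "chord r \<equiv> contour_integral (linepath (of_real r) (\<i> * of_real r)) f"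
  shows "integral {\<epsilon>..R} (\<lambda>x. f (of_real x)) - integral {\<epsilon>..R} (\<lambda>x. \<i> * f (\<i> * of_real x))
       = chord \<epsilon> - chord R"
    and "(\<lambda>x. f (of_real x)) integrable_on {\<epsilon>..R}"
    and "(\<lambda>x. \<i> * f (\<i> * of_real x)) integrable_on {\<epsilon>..R}"
proof -
  let ?e = "complex_of_real \<epsilon>" and ?R = "complex_of_real R"
  note q = quadrant_line[OF \<open>0 < \<epsilon>\<close>] quadrant_line[of R]
  have seg: "closed_segment a b \<subseteq> quadrant" if "a \<in> quadrant" "b \<in> quadrant" for a b
    using convex_contains_segment[of quadrant] convex_quadrant that by blast
  have cont: "continuous_on quadrant f" using f by (rule holomorphic_on_imp_continuous_on)
  have ci: "f contour_integrable_on linepath a b" if "a \<in> quadrant" "b \<in> quadrant" for a b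
    using seg[OF that] cont by (intro contour_integrable_continuous_linepath) (auto intro: continuous_on_subset)
  let ?g = "linepath ?e ?R +++ linepath ?R (\<i> * ?R) +++ linepath (\<i> * ?R) (\<i> * ?e) +++ linepath (\<i> * ?e) ?e"
  have "(f has_contour_integral 0) ?g"
    using q assms(2,3) seg
    by (intro Cauchy_theorem_convex_simple[OF f convex_quadrant]) (auto simp: path_image_join)
  moreover have "(f has_contour_integral (contour_integral (linepath ?e ?R) f + (chord R
      + (contour_integral (linepath (\<i> * ?R) (\<i> * ?e)) f + contour_integral (linepath (\<i> * ?e) ?e) f)))) ?g"
    unfolding chord_def using q assms(2,3) ci
    by (intro has_contour_integral_join has_contour_integral_integral valid_path_join) auto
  ultimately have sum0: "contour_integral (linepath ?e ?R) f + (chord R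
      + (contour_integral (linepath (\<i> * ?R) (\<i> * ?e)) f + contour_integral (linepath (\<i> * ?e) ?e) f)) = 0"
    by (rule has_contour_integral_unique[symmetric])
  have rev: "contour_integral (linepath (\<i> * ?e) ?e) f = - chord \<epsilon>"
     "contour_integral (linepath (\<i> * ?R) (\<i> * ?e)) f = - contour_integral (linepath (\<i> * ?e) (\<i> * ?R)) f"
    unfolding chord_def using q assms(2,3) seg cont
    by (auto intro!: contour_integral_reverse_linepath elim!: continuous_on_subset)
  have I1: "contour_integral (linepath ?e ?R) f = integral {\<epsilon>..R} (\<lambda>x. f (of_real x))"
    using assms(2,3) by (subst contour_integral_linepath_Reals_eq) auto
  have "(f has_contour_integral (contour_integral (linepath (\<i> * ?e) (\<i> * ?R)) f)) (linepath (\<i> * ?e) (\<i> * ?R))"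
    using q assms(2,3) ci by (intro has_contour_integral_integral) auto
  then have "((\<lambda>x. f (linepath (\<i> * ?e) (\<i> * ?R) x) * (\<i> * ?R - \<i> * ?e)) has_integral
      contour_integral (linepath (\<i> * ?e) (\<i> * ?R)) f) {0..1}"
    by (simp add: has_contour_integral_linepath)
  also have "(\<lambda>x. f (linepath (\<i> * ?e) (\<i> * ?R) x) * (\<i> * ?R - \<i> * ?e)) =
     (\<lambda>x. (\<i> * f (\<i> * linepath ?e ?R x)) * (?R - ?e))"
    by (simp add: linepath_def scaleR_conv_of_real algebra_simps)
  finally have "((\<lambda>z. \<i> * f (\<i> * z)) has_contour_integral
      contour_integral (linepath (\<i> * ?e) (\<i> * ?R)) f) (linepath ?e ?R)"
    by (simp add: has_contour_integral_linepath)
  then have I2: "contour_integral (linepath (\<i> * ?e) (\<i> * ?R)) f = integral {\<epsilon>..R} (\<lambda>x. \<i> * f (\<i> * of_real x))"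
    using assms(2,3) by (subst (asm) has_contour_integral_linepath_Reals_iff) (auto dest: integral_unique)
  have "continuous_on {\<epsilon>..R} (\<lambda>x. f (\<i> * of_real x))"
    using assms(2,3) quadrant_line by (intro continuous_on_compose2[OF cont] continuous_intros) auto
  then show int: "(\<lambda>x. \<i> * f (\<i> * of_real x)) integrable_on {\<epsilon>..R}"
    by (intro integrable_continuous_interval continuous_intros)
  have "continuous_on {\<epsilon>..R} (\<lambda>x. f (of_real x))"
    using assms(2,3) quadrant_line by (intro continuous_on_compose2[OF cont] continuous_intros) auto
  then show "(\<lambda>x. f (of_real x)) integrable_on {\<epsilon>..R}"
    by (rule integrable_continuous_interval)
  show "integral {\<epsilon>..R} (\<lambda>x. f (of_real x)) - integral {\<epsilon>..R} (\<lambda>x. \<i> * f (\<i> * of_real x))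
       = chord \<epsilon> - chord R"
    using sum0 unfolding rev I1 I2 by (simp add: algebra_simps)
qed

text \<open>One parameter drives both cutoffs, \<open>1/R\<close> at the vertex and \<open>R\<close>
  at infinity. Only the difference of the two sides is controlled, because neither integral is
  assumed to converge.\<close>

lemma tendsto_integral_quadrant:
  assumes f: "f holomorphic_on quadrant"
    and far: "((\<lambda>R. contour_integral (linepath (of_real R) (\<i> * of_real R)) f) \<longlongrightarrow> 0) at_top"
    and near: "((\<lambda>R. contour_integral (linepath (of_real R) (\<i> * of_real R)) f) \<longlongrightarrow> 0) (at_right 0)"
  shows "((\<lambda>R. integral {1/R..R} (\<lambda>x. Re (f (of_real x))) -
      integral {1/R..R} (\<lambda>x. Re (\<i> * f (\<i> * of_real x)))) \<longlongrightarrow> 0) at_top"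
proof -
  define chord where "chord r = contour_integral (linepath (of_real r) (\<i> * of_real r)) f" for r :: real
  have "filterlim (\<lambda>R::real. 1 / R) (at_right 0) at_top"
    using filterlim_inverse_at_right_top by (simp add: inverse_eq_divide)
  then have near': "((\<lambda>R. chord (1/R)) \<longlongrightarrow> 0) at_top"
    using filterlim_compose[OF near[folded chord_def]] by blast
  have "((\<lambda>R. Re (chord (1/R) - chord R)) \<longlongrightarrow> Re (0 - 0)) at_top"
    by (intro tendsto_intros near' far[folded chord_def])
  then have "((\<lambda>R. Re (chord (1/R) - chord R)) \<longlongrightarrow> 0) at_top" by simp
  moreover have "\<forall>\<^sub>F R in at_top. Re (chord (1/R) - chord R) =
     integral {1/R..R} (\<lambda>x. Re (f (of_real x))) - integral {1/R..R} (\<lambda>x. Re (\<i> * f (\<i> * of_real x)))"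
    using eventually_gt_at_top[of 1]
  proof eventually_elim
    case (elim R)
    then have R: "0 < 1/R" "1/R < R" by (auto simp: divide_less_eq intro: less_1_mult)
    note I = contour_integral_quadrant[OF f R, folded chord_def]
    have "Re (integral {1/R..R} (\<lambda>x. f (of_real x))) = integral {1/R..R} (\<lambda>x. Re (f (of_real x)))"
      by (rule integral_unique[symmetric], rule has_integral_Re, rule integrable_integral, rule I)
    moreover have "Re (integral {1/R..R} (\<lambda>x. \<i> * f (\<i> * of_real x))) = integral {1/R..R} (\<lambda>x. Re (\<i> * f (\<i> * of_real x)))"
      by (rule integral_unique[symmetric], rule has_integral_Re, rule integrable_integral, rule I)
    ultimately show ?case unfolding I(1)[symmetric] by simp
  qed
  ultimately show ?thesis by (rule Lim_transform_eventually)
qed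

lemma norm_chord_le: "0 < R \<Longrightarrow> cmod (\<i> * of_real R - of_real R) \<le> 2 * R"
  using norm_triangle_ineq4[of "\<i> * complex_of_real R" "of_real R"] by (simp add: norm_mult)

lemma contour_integral_chord_bound:
  assumes f: "continuous_on quadrant f" and "0 < R" "0 \<le> B"
    and B: "\<And>z. z \<in> closed_segment (of_real R) (\<i> * of_real R) \<Longrightarrow> cmod (f z) \<le> B"
  shows "cmod (contour_integral (linepath (of_real R) (\<i> * of_real R)) f) \<le> 2 * B * R"
proof -
  have "f contour_integrable_on linepath (of_real R) (\<i> * of_real R)"
    using chord_bounds(1)[OF \<open>0 < R\<close>] 
    by (intro contour_integrable_continuous_linepath continuous_on_subset[OF f]) auto
  then have "cmod (contour_integral (linepath (of_real R) (\<i> * of_real R)) f) \<le> B * cmod (\<i> * of_real R - of_real R)"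
    by (intro has_contour_integral_bound_linepath[OF has_contour_integral_integral] assms)
  also have "\<dots> \<le> B * (2 * R)"
    by (intro mult_left_mono norm_chord_le assms)
  finally show ?thesis by simp
qed

text \<open>Jordan's lemma on a chord: \<open>Im z\<close> grows linearly along it, so integrating
  the exponential gains a factor of order \<open>1 / (t * R)\<close>, which cancels the length of
  the chord. The plain length bound would not suffice for an integrand decaying only like
  \<open>R powr (2 * s - 2)\<close> when \<open>s \<ge> 1/2\<close>.\<close>

lemma contour_integral_chord_bound_exp:
  assumes f: "continuous_on quadrant f" and "0 < R" "0 \<le> B" "0 < t"
    and B: "\<And>z. z \<in> closed_segment (of_real R) (\<i> * of_real R) \<Longrightarrow> cmod (f z) \<le> B * exp (- t * Im z)"
  shows "cmod (contour_integral (linepath (of_real R) (\<i> * of_real R)) f) \<le> 2 * B / t"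
proof -
  let ?l = "linepath (complex_of_real R) (\<i> * of_real R)"
  have "f contour_integrable_on ?l"
    using chord_bounds(1)[OF \<open>0 < R\<close>] 
    by (intro contour_integrable_continuous_linepath continuous_on_subset[OF f]) auto
  then have I: "((\<lambda>x. f (?l x) * (\<i> * of_real R - of_real R)) has_integral contour_integral ?l f) {0..1}"
    using has_contour_integral_integral has_contour_integral_linepath by blast
  have E: "((\<lambda>x. B * (2 * R) * exp (- t * (x * R))) has_integral
      (- 2 * B / t * exp (- t * (1 * R)) - - 2 * B / t * exp (- t * (0 * R)))) {0..1}"
    using assms(2-4) by (intro fundamental_theorem_of_calculus)
      (auto intro!: derivative_eq_intros simp: has_real_derivative_iff_has_vector_derivative[symmetric])
  have "cmod (contour_integral ?l f) = cmod (integral {0..1} (\<lambda>x. f (?l x) * (\<i> * of_real R - of_real R)))"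
    by (simp only: integral_unique[OF I])
  also have "\<dots> \<le> integral {0..1} (\<lambda>x. B * (2 * R) * exp (- t * (x * R)))"
  proof (rule integral_norm_bound_integral)
    show "cmod (f (?l x) * (\<i> * of_real R - of_real R)) \<le> B * (2 * R) * exp (- t * (x * R))"
      if "x \<in> {0..1}" for x
    proof -
      have "?l x \<in> closed_segment (of_real R) (\<i> * of_real R)"
        using that by (auto simp: linepath_in_path)
      then have "cmod (f (?l x)) \<le> B * exp (- t * Im (?l x))" by (rule B)
      also have "Im (?l x) = x * R" by (simp add: linepath_def)
      finally have "cmod (f (?l x)) * cmod (\<i> * of_real R - of_real R) \<le> B * exp (- t * (x * R)) * (2 * R)"
        using assms norm_chord_le by (intro mult_mono) auto
      then show ?thesis by (simp add: norm_mult mult_ac)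
    qed
  qed (use I E in \<open>auto simp: integrable_on_def\<close>)
  also have "\<dots> = - 2 * B / t * exp (- t * (1 * R)) - - 2 * B / t * exp (- t * (0 * R))"
    using E by (rule integral_unique)
  also have "\<dots> \<le> 2 * B / t" using assms by simp
  finally show ?thesis .
qed

section \<open>The weights on the two half-axes, sector bounds, and the two contour
  rotations\<close>

locale frac_order =
  fixes s :: real
  assumes s: "0 < s" "s < 1"
begin

text \<open>For \<open>x > 0\<close> this is \<open>x^(2 s) / (x^2 + x^(2 s))\<close>, the ratio of
  the fractional symbol to the symbol of the mixed operator.\<close>

definition \<phi> :: "real \<Rightarrow> real" where "\<phi> x = 1 / (1 + x powr (2 - 2 * s))"

text \<open>The quadratic in the denominator is \<open>\<bar>1 + (i l)^(2 - 2 s)\<bar>\<^sup>2\<close>.\<close>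

definition \<mu> :: "real \<Rightarrow> real" where
  "\<mu> l = sin (pi * s) * l powr (2 - 2 * s) /
     (1 - 2 * cos (pi * s) * l powr (2 - 2 * s) + (l powr (2 - 2 * s))\<^sup>2)"

lemma sin_pos: "0 < sin (pi * s)"
  using s by (intro sin_gt_zero) auto

text \<open>Two ways of completing the square: around \<open>x\<close>, leaving
  \<open>sin^2\<close>, and around the constant 1, leaving \<open>(sin * x)^2\<close>. The first is
  the useful bound for small \<open>x\<close>, the second for large \<open>x\<close>.\<close>

lemma quadratic_lower_bounds:
  "(sin (pi * s))\<^sup>2 \<le> 1 - 2 * cos (pi * s) * x + x\<^sup>2"
  "(sin (pi * s) * x)\<^sup>2 \<le> 1 - 2 * cos (pi * s) * x + x\<^sup>2"
proof -
  have "1 - 2 * cos (pi * s) * x + x\<^sup>2 = (x - cos (pi * s))\<^sup>2 + (sin (pi * s))\<^sup>2"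
    by (simp add: power2_eq_square algebra_simps sin_squared_eq[unfolded power2_eq_square])
  then show "(sin (pi * s))\<^sup>2 \<le> 1 - 2 * cos (pi * s) * x + x\<^sup>2" by simp
  have "1 - 2 * cos (pi * s) * x + x\<^sup>2 = (1 - cos (pi * s) * x)\<^sup>2 + (sin (pi * s) * x)\<^sup>2"
    unfolding power_mult_distrib sin_squared_eq by (simp add: power2_eq_square algebra_simps)
  then show "(sin (pi * s) * x)\<^sup>2 \<le> 1 - 2 * cos (pi * s) * x + x\<^sup>2" by simp
qed

lemma quadratic_pos: "0 < 1 - 2 * cos (pi * s) * x + x\<^sup>2"
  using quadratic_lower_bounds(1)[of x] sin_pos by (meson less_le_trans zero_less_power)

lemma \<mu>_nonneg: "0 \<le> \<mu> l" and \<mu>_pos: "0 < l \<Longrightarrow> 0 < \<mu> l"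
  unfolding \<mu>_def using sin_pos quadratic_pos[of "l powr (2 - 2 * s)"]
  by (auto intro!: divide_nonneg_pos mult_nonneg_nonneg divide_pos_pos mult_pos_pos simp: less_imp_le)

text \<open>The two bounds of the quadratic denominator, giving the behaviour of
  \<open>\<mu>\<close> at 0 and at infinity respectively.\<close>

lemma \<mu>_le:
  "\<mu> l \<le> l powr (2 - 2 * s) / sin (pi * s)"
  "0 < l \<Longrightarrow> \<mu> l \<le> l powr (2 * s - 2) / sin (pi * s)"
proof -
  let ?L = "l powr (2 - 2 * s)" and ?S = "sin (pi * s)"
  have "\<mu> l \<le> ?S * ?L / ?S\<^sup>2"
    unfolding \<mu>_def using sin_pos quadratic_lower_bounds(1)[of ?L]
    by (intro divide_left_mono mult_pos_pos quadratic_pos) auto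
  then show "\<mu> l \<le> ?L / ?S" using sin_pos by (simp add: power2_eq_square)
  assume l: "0 < l"
  have "\<mu> l \<le> ?S * ?L / (?S * ?L)\<^sup>2"
    unfolding \<mu>_def using sin_pos l quadratic_lower_bounds(2)[of ?L]
    by (intro divide_left_mono mult_pos_pos quadratic_pos) auto
  also have "\<dots> = 1 / ?L / ?S" using sin_pos l by (simp add: power2_eq_square field_simps)
  also have "1 / ?L = l powr (2 * s - 2)"
    by (simp add: powr_minus[symmetric] divide_inverse)
  finally show "\<mu> l \<le> l powr (2 * s - 2) / ?S" .
qed

lemma measurable_\<phi>_\<mu> [measurable]: "\<phi> \<in> borel_measurable borel" "\<mu> \<in> borel_measurable borel"
  unfolding \<phi>_def \<mu>_def by measurable

text \<open>In the last bound, \<open>x powr r\<close> is at most 1 for \<open>x \<le> 1\<close> and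
  at most \<open>x powr (2 - 2 * s)\<close> afterwards. The exponent is left free:
  \<open>2 - 2 * s\<close> is the true decay at infinity, and \<open>1 - s\<close> later controls
  truncated integrals of \<open>\<phi>\<close>.\<close>

lemma \<phi>_nonneg: "0 \<le> \<phi> x" and \<phi>_le_1: "\<phi> x \<le> 1"
  and \<phi>_le: "0 < x \<Longrightarrow> 0 \<le> r \<Longrightarrow> r \<le> 2 - 2 * s \<Longrightarrow> \<phi> x \<le> x powr - r"
proof -
  have pos: "0 < 1 + x powr (2 - 2 * s)" by (simp add: add_pos_nonneg)
  show "0 \<le> \<phi> x" "\<phi> x \<le> 1" using pos unfolding \<phi>_def by (auto simp: divide_simps)
  assume "0 < x" "0 \<le> r" "r \<le> 2 - 2 * s"
  then have "x powr r \<le> 1 + x powr (2 - 2 * s)"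
    using powr_mono[of r "2 - 2 * s" x] powr_mono_both[of r 0 x 1]
    by (cases "x \<le> 1") (auto simp: powr_le1 add_increasing2 add_increasing)
  then show "\<phi> x \<le> x powr - r"
    unfolding \<phi>_def powr_minus using \<open>0 < x\<close> pos by (simp add: field_simps)
qed

definition zpow :: "complex \<Rightarrow> complex" where "zpow z = z powr of_real (2 - 2 * s)"

lemma zpow_of_real: "0 < x \<Longrightarrow> zpow (of_real x) = of_real (x powr (2 - 2 * s))"
  unfolding zpow_def by (subst powr_of_real) auto

lemma zpow_ii: 
  assumes "0 < l" 
  shows "zpow (\<i> * of_real l) = of_real (l powr (2 - 2 * s)) * Complex (- cos (pi * s)) (sin (pi * s))"
proof -
  have "Ln (\<i> * of_real l) = of_real (ln l) + \<i> * of_real (pi / 2)"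
    using Ln_times_of_real[of l \<i>] assms by (simp add: mult.commute Ln_of_real)
  then have "zpow (\<i> * of_real l) = exp (of_real ((2 - 2 * s) * ln l)) * exp (\<i> * of_real (pi - pi * s))"
    unfolding zpow_def powr_def using assms by (simp add: exp_add[symmetric] algebra_simps)
  also have "exp (of_real ((2 - 2 * s) * ln l)) = complex_of_real (l powr (2 - 2 * s))"
    using assms by (simp add: powr_def exp_of_real[symmetric])
  also have "exp (\<i> * of_real (pi - pi * s)) = cis (pi - pi * s)"
    by (rule cis_conv_exp[symmetric])
  also have "cis (pi - pi * s) = Complex (- cos (pi * s)) (sin (pi * s))"
    by (simp add: cis.ctr)
  finally show ?thesis .
qed

lemma quadrant_nonpos: "z \<in> quadrant \<Longrightarrow> z \<notin> \<real>\<^sub>\<le>\<^sub>0"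
  by (auto simp: quadrant_def complex_nonpos_Reals_iff complex_eq_iff)

lemma holomorphic_zpow: "zpow holomorphic_on quadrant"
  unfolding zpow_def by (intro holomorphic_intros) (auto simp: quadrant_nonpos)

lemma norm_zpow: "cmod (zpow z) = cmod z powr (2 - 2 * s)"
  unfolding zpow_def by (subst norm_powr_real_powr') auto

text \<open>On the quadrant the argument of \<open>z^(2 - 2 s)\<close> lies between 0 and
  \<open>pi - pi * s\<close>, strictly below \<open>pi\<close> since \<open>s > 0\<close>. So its
  cosine is at least \<open>- cos (pi * s)\<close>, and the squared modulus is bounded below by the
  quadratic above. In particular there is no pole and the rotation produces no residue.\<close>

lemma norm_one_plus_zpow:
  assumes "z \<in> quadrant"
  shows "sin (pi * s) \<le> cmod (1 + zpow z)" "sin (pi * s) * cmod z powr (2 - 2 * s) \<le> cmod (1 + zpow z)"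
    "1 + zpow z \<noteq> 0"
proof -
  define \<rho> where "\<rho> = cmod z powr (2 - 2 * s)"
  have z: "0 \<le> Re z" "0 \<le> Im z" "z \<noteq> 0" using assms by (auto simp: quadrant_def)
  have "0 \<le> Arg z" "Arg z \<le> pi / 2"
    using z Arg_Re_nonneg[of z] Arg_less_0[of z] by auto
  then have "0 \<le> (2 - 2 * s) * Arg z" "(2 - 2 * s) * Arg z \<le> (2 - 2 * s) * (pi / 2)"
    using s by (auto intro!: mult_nonneg_nonneg mult_left_mono)
  then have A: "0 \<le> (2 - 2 * s) * Arg z" "(2 - 2 * s) * Arg z \<le> pi - pi * s"
    by (auto simp: field_simps)
  have "Ln z = of_real (ln (cmod z)) + \<i> * of_real (Arg z)"
    using z by (simp add: complex_eq_iff Arg_eq_Im_Ln)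
  then have "zpow z = exp (of_real ((2 - 2 * s) * ln (cmod z))) * exp (\<i> * of_real ((2 - 2 * s) * Arg z))"
    unfolding zpow_def powr_def using z by (simp add: exp_add[symmetric] algebra_simps)
  also have "exp (of_real ((2 - 2 * s) * ln (cmod z))) = complex_of_real \<rho>"
    using z by (simp add: powr_def \<rho>_def exp_of_real[symmetric])
  also have "exp (\<i> * of_real ((2 - 2 * s) * Arg z)) = cis ((2 - 2 * s) * Arg z)"
    by (rule cis_conv_exp[symmetric])
  finally have "Re (zpow z) = \<rho> * cos ((2 - 2 * s) * Arg z)"
    by (simp only: times_complex.sel cis.sel Re_complex_of_real Im_complex_of_real mult_zero_left diff_zero)
  moreover have "cos (pi - pi * s) \<le> cos ((2 - 2 * s) * Arg z)"
    using A s by (intro cos_monotone_0_pi_le) auto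
  then have "- cos (pi * s) \<le> cos ((2 - 2 * s) * Arg z)" by simp
  moreover have "0 \<le> \<rho>" by (simp add: \<rho>_def)
  ultimately have re: "- cos (pi * s) * \<rho> \<le> Re (zpow z)"
    using mult_left_mono[of "- cos (pi * s)" "cos ((2 - 2 * s) * Arg z)" \<rho>] by (simp add: mult.commute)
  have "(cmod (1 + zpow z))\<^sup>2 = 1 + 2 * Re (zpow z) + (cmod (zpow z))\<^sup>2"
    unfolding cmod_power2 by (simp add: power2_sum)
  also have "(cmod (zpow z))\<^sup>2 = \<rho>\<^sup>2" by (simp add: norm_zpow \<rho>_def)
  finally have *: "1 - 2 * cos (pi * s) * \<rho> + \<rho>\<^sup>2 \<le> (cmod (1 + zpow z))\<^sup>2"
    using re by linarith
  show 1: "sin (pi * s) \<le> cmod (1 + zpow z)"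
    by (rule power2_le_imp_le[OF order_trans[OF quadratic_lower_bounds(1) *]]) simp
  show "sin (pi * s) * cmod z powr (2 - 2 * s) \<le> cmod (1 + zpow z)"
    by (rule power2_le_imp_le[OF order_trans[OF quadratic_lower_bounds(2) *], unfolded \<rho>_def]) simp
  show "1 + zpow z \<noteq> 0" using 1 sin_pos by auto
qed

text \<open>The origin of \<open>\<mu>\<close>: it is the real part left on the imaginary axis after
  the contour rotation.\<close>

lemma Re_ii_inverse:
  assumes "0 < l"
  shows "Re (\<i> / (1 + zpow (\<i> * of_real l))) = \<mu> l"
proof -
  define L where "L = l powr (2 - 2 * s)"
  have w: "zpow (\<i> * of_real l) = Complex (- L * cos (pi * s)) (L * sin (pi * s))"
    unfolding zpow_ii[OF assms] L_def by (simp add: complex_eq_iff)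
  have "(1 - L * cos (pi * s))\<^sup>2 + (L * sin (pi * s))\<^sup>2 = 1 - 2 * cos (pi * s) * L + L\<^sup>2"
    unfolding power_mult_distrib sin_squared_eq by (simp add: power2_eq_square algebra_simps)
  then show ?thesis
    unfolding w \<mu>_def L_def[symmetric] by (simp add: Re_divide)
qed

lemma tendsto_powr_at_right_0: "((\<lambda>x::real. C * x powr (2 - 2 * s)) \<longlongrightarrow> 0) (at_right 0)"
proof -
  have "((\<lambda>x::real. x powr (2 - 2 * s)) \<longlongrightarrow> 0 powr (2 - 2 * s)) (at_right 0)"
    using s by (intro tendsto_powr') (auto intro!: tendsto_ident_at eventually_at_right_less[THEN eventually_mono] simp: eventually_at_right_less)
  then show ?thesis
    using tendsto_mult_right_zero by fastforce
qed

text \<open>Rotates \<open>exp (i t z) / (1 + z^(2 - 2 s))\<close>. Near the vertex the integrand is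
  bounded, so the length of the chord suffices; at infinity the Jordan-type bound is needed.\<close>

lemma tendsto_integral_cos_\<phi>:
  assumes t: "0 < t"
  shows "((\<lambda>R. integral {1/R..R} (\<lambda>x. cos (t * x) * \<phi> x) -
      integral {1/R..R} (\<lambda>l. exp (- (t * l)) * \<mu> l)) \<longlongrightarrow> 0) at_top"
proof -
  define f where "f z = exp (\<i> * of_real t * z) / (1 + zpow z)" for z
  have f: "f holomorphic_on quadrant"
    unfolding f_def using norm_one_plus_zpow(3) by (intro holomorphic_intros holomorphic_zpow) auto
  note cont = holomorphic_on_imp_continuous_on[OF f]
  let ?c = "\<lambda>R. contour_integral (linepath (of_real R) (\<i> * of_real R)) f"
  have near: "(?c \<longlongrightarrow> 0) (at_right 0)"
  proof (rule Lim_null_comparison)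
    show "\<forall>\<^sub>F R in at_right 0. cmod (?c R) \<le> 2 * (1 / sin (pi * s)) * R"
      using eventually_at_right_less
    proof eventually_elim
      case (elim R)
      show ?case
      proof (rule contour_integral_chord_bound[OF cont elim])
        fix z assume "z \<in> closed_segment (complex_of_real R) (\<i> * of_real R)"
        from chord_bounds(1)[OF elim this] have z: "z \<in> quadrant" .
        then have "cmod (exp (\<i> * of_real t * z)) \<le> 1" using t by (auto simp: quadrant_def)
        then show "cmod (f z) \<le> 1 / sin (pi * s)"
          unfolding f_def norm_divide using norm_one_plus_zpow(1)[OF z] sin_pos by (intro frac_le) auto
      qed (use sin_pos in auto)
    qed
    show "((\<lambda>R. 2 * (1 / sin (pi * s)) * R) \<longlongrightarrow> 0) (at_right 0)"
      by (intro tendsto_mult_right_zero tendsto_ident_at)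
  qed
  have far: "(?c \<longlongrightarrow> 0) at_top"
  proof (rule Lim_null_comparison)
    show "\<forall>\<^sub>F R in at_top. cmod (?c R) \<le> 2 * (1 / (sin (pi * s) * (R / 2) powr (2 - 2 * s))) / t"
      using eventually_gt_at_top[of 0]
    proof eventually_elim
      case (elim R)
      show ?case
      proof (rule contour_integral_chord_bound_exp[OF cont elim _ t])
        fix z assume "z \<in> closed_segment (complex_of_real R) (\<i> * of_real R)"
        note z = chord_bounds[OF elim this]
        have "(R / 2) powr (2 - 2 * s) \<le> cmod z powr (2 - 2 * s)"
          using z elim s by (intro powr_mono2) auto
        then have "sin (pi * s) * (R / 2) powr (2 - 2 * s) \<le> cmod (1 + zpow z)"
          using norm_one_plus_zpow(2)[OF z(1)] sin_pos by (meson mult_left_mono less_imp_le order_trans)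
        then have "cmod (f z) \<le> exp (- t * Im z) / (sin (pi * s) * (R / 2) powr (2 - 2 * s))"
          unfolding f_def norm_divide using sin_pos elim by (intro frac_le) auto
        then show "cmod (f z) \<le> 1 / (sin (pi * s) * (R / 2) powr (2 - 2 * s)) * exp (- t * Im z)"
          by simp
      qed (use sin_pos in auto)
    qed
    show "((\<lambda>R. 2 * (1 / (sin (pi * s) * (R / 2) powr (2 - 2 * s))) / t) \<longlongrightarrow> 0) at_top"
      using s sin_pos t by real_asymp
  qed
  have re: "Re (f (of_real x)) = cos (t * x) * \<phi> x" if "0 < x" for x
  proof -
    have "f (of_real x) = cis (t * x) * of_real (\<phi> x)"
      unfolding f_def zpow_of_real[OF that] \<phi>_def by (simp add: cis_conv_exp mult_ac)
    then show ?thesis by simp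
  qed
  have im: "Re (\<i> * f (\<i> * of_real l)) = exp (- (t * l)) * \<mu> l" if "0 < l" for l
  proof -
    have "\<i> * f (\<i> * of_real l) = of_real (exp (- (t * l))) * (\<i> / (1 + zpow (\<i> * of_real l)))"
      unfolding f_def by (simp add: exp_of_real[symmetric] algebra_simps)
    then show ?thesis
      by (simp only: Re_ii_inverse[OF that] times_complex.sel Re_complex_of_real Im_complex_of_real mult_zero_left diff_zero)
  qed
  show ?thesis
  proof (rule Lim_transform_eventually[OF tendsto_integral_quadrant[OF f far near]])
    show "\<forall>\<^sub>F R in at_top. integral {1/R..R} (\<lambda>x. Re (f (of_real x))) - integral {1/R..R} (\<lambda>l. Re (\<i> * f (\<i> * of_real l))) =
       integral {1/R..R} (\<lambda>x. cos (t * x) * \<phi> x) - integral {1/R..R} (\<lambda>l. exp (- (t * l)) * \<mu> l)"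
      using eventually_gt_at_top[of 0]
    proof eventually_elim
      case (elim R)
      then have "0 < x" if "x \<in> {1/R..R}" for x 
        using that by (meson atLeastAtMost_iff divide_pos_pos less_le_trans zero_less_one)
      then show ?case
        by (intro arg_cong2[where f = "(-)"] integral_cong re im) auto
    qed
  qed
qed

text \<open>The rotation behind the Laplace form of \<open>F\<close>. Here the factor
  \<open>z^(-2)\<close> gives decay of order \<open>R^(-2)\<close> at infinity, so the length bound
  is enough there; at the vertex the zero of \<open>1 - exp (i t z)\<close> makes the chord integral
  of order \<open>R powr (2 - 2 * s)\<close>.\<close>

lemma tendsto_integral_one_minus_cos:
  assumes t: "0 < t"
  shows "((\<lambda>R. integral {1/R..R} (\<lambda>x. (1 - cos (t * x)) * (x powr (- 2 * s) * \<phi> x)) -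
      integral {1/R..R} (\<lambda>l. (1 - exp (- (t * l))) * (\<mu> l / l\<^sup>2))) \<longlongrightarrow> 0) at_top"
proof -
  \<comment> \<open>The weight \<open>z^(- 2 s)\<close> is written as
    \<open>z^(2 - 2 s) / z^2\<close>, so that a single non-integer power occurs and the sector
    bounds for \<open>1 + zpow z\<close> apply directly.\<close>
  define f where "f z = (1 - exp (\<i> * of_real t * z)) * zpow z / (z\<^sup>2 * (1 + zpow z))" for z
  have f: "f holomorphic_on quadrant"
    unfolding f_def using norm_one_plus_zpow(3) by (intro holomorphic_intros holomorphic_zpow) (auto simp: quadrant_def)
  note cont = holomorphic_on_imp_continuous_on[OF f]
  let ?c = "\<lambda>R. contour_integral (linepath (of_real R) (\<i> * of_real R)) f"
  have near: "(?c \<longlongrightarrow> 0) (at_right 0)"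
  proof (rule Lim_null_comparison)
    \<comment> \<open>\<open>t * exp t\<close> comes from the first-order Taylor bound of the
      exponential with \<open>\<bar>Im z\<bar> \<le> R < 1\<close>, the factor 2 from
      \<open>cmod z \<ge> R / 2\<close>, and the sine from the lower bound of the
      denominator.\<close>
    define K where "K = 2 * t * exp t / sin (pi * s)"
    have "0 \<le> K" using t sin_pos by (simp add: K_def)
    have "\<forall>\<^sub>F R::real in at_right 0. 0 < R \<and> R < 1"
      by (rule eventually_at_rightI[of 0 1]) auto
    then show "\<forall>\<^sub>F R in at_right 0. cmod (?c R) \<le> 2 * K * R powr (2 - 2 * s)"
    proof eventually_elim
      case (elim R)
      then have R: "0 < R" by simp
      have "cmod (?c R) \<le> 2 * (K * R powr (2 - 2 * s) / R) * R"
      proof (rule contour_integral_chord_bound[OF cont R])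
        fix z assume "z \<in> closed_segment (complex_of_real R) (\<i> * of_real R)"
        note z = chord_bounds[OF R this]
        have z0: "z \<noteq> 0" using z R by auto
        have "cmod (exp (\<i> * of_real t * z) - (\<Sum>k\<le>0. (\<i> * of_real t * z) ^ k / fact k))
           \<le> exp \<bar>Re (\<i> * of_real t * z)\<bar> * cmod (\<i> * of_real t * z) ^ Suc 0 / fact 0"
          by (rule Taylor_exp)
        also have "\<dots> = exp (t * \<bar>Im z\<bar>) * (t * cmod z)"
          using t by (simp add: norm_mult abs_mult)
        also have "\<dots> \<le> exp t * (t * cmod z)"
          using t elim z abs_Im_le_cmod[of z] by (intro mult_right_mono) (auto simp: mult_le_cancel_left1)
        finally have "cmod (1 - exp (\<i> * of_real t * z)) \<le> exp t * (t * cmod z)"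
          by (simp add: norm_minus_commute)
        then have "cmod (f z) \<le> exp t * (t * cmod z) * cmod z powr (2 - 2 * s) / ((cmod z)\<^sup>2 * sin (pi * s))"
          unfolding f_def norm_divide norm_mult norm_power norm_zpow
          using norm_one_plus_zpow(1)[OF z(1)] sin_pos z0 t by (intro frac_le mult_mono) auto
        also have "\<dots> = exp t * t * cmod z powr (2 - 2 * s) / (cmod z * sin (pi * s))"
          using z0 by (simp add: power2_eq_square)
        also have "\<dots> \<le> exp t * t * R powr (2 - 2 * s) / (R / 2 * sin (pi * s))"
          using z R sin_pos t s by (intro frac_le mult_left_mono mult_right_mono powr_mono2) auto
        also have "\<dots> = K * R powr (2 - 2 * s) / R"
          by (simp add: K_def mult_ac)
        finally show "cmod (f z) \<le> K * R powr (2 - 2 * s) / R" .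
      qed (use \<open>0 \<le> K\<close> R in auto)
      then show ?case using R by simp
    qed
    show "((\<lambda>R. 2 * K * R powr (2 - 2 * s)) \<longlongrightarrow> 0) (at_right 0)"
      by (rule tendsto_powr_at_right_0)
  qed
  have far: "(?c \<longlongrightarrow> 0) at_top"
  proof (rule Lim_null_comparison)
    show "\<forall>\<^sub>F R in at_top. cmod (?c R) \<le> 2 * (2 / ((R / 2)\<^sup>2 * sin (pi * s))) * R"
      using eventually_gt_at_top[of 0]
    proof eventually_elim
      case (elim R)
      show ?case
      proof (rule contour_integral_chord_bound[OF cont elim])
        fix z assume "z \<in> closed_segment (complex_of_real R) (\<i> * of_real R)"
        note z = chord_bounds[OF elim this]
        have z0: "z \<noteq> 0" using z elim by auto
        have "cmod (exp (\<i> * of_real t * z)) \<le> 1" using t z by (auto simp: quadrant_def)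
        then have "cmod (1 - exp (\<i> * of_real t * z)) \<le> 2"
          using norm_triangle_ineq4[of 1 "exp (\<i> * of_real t * z)"] norm_one[where 'a=complex] by linarith
        then have "cmod (f z) \<le> 2 * cmod z powr (2 - 2 * s) / ((cmod z)\<^sup>2 * (sin (pi * s) * cmod z powr (2 - 2 * s)))"
          unfolding f_def norm_divide norm_mult norm_power norm_zpow
          using norm_one_plus_zpow(2)[OF z(1)] sin_pos z0 t by (intro frac_le mult_mono) auto
        also have "\<dots> = 2 / ((cmod z)\<^sup>2 * sin (pi * s))"
          using z0 by simp
        also have "\<dots> \<le> 2 / ((R / 2)\<^sup>2 * sin (pi * s))"
          using z elim sin_pos by (intro frac_le mult_right_mono power_mono) auto
        finally show "cmod (f z) \<le> 2 / ((R / 2)\<^sup>2 * sin (pi * s))" .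
      qed (use sin_pos in auto)
    qed
    show "((\<lambda>R. 2 * (2 / ((R / 2)\<^sup>2 * sin (pi * s))) * R) \<longlongrightarrow> 0) at_top"
      using sin_pos by real_asymp
  qed
  have re: "Re (f (of_real x)) = (1 - cos (t * x)) * (x powr (- 2 * s) * \<phi> x)" if "0 < x" for x
  proof -
    have "x powr (- 2 * s) = x powr (2 - 2 * s) / x\<^sup>2"
      using that powr_diff[of x "2 - 2 * s" 2] by (simp add: powr_numeral)
    then have "f (of_real x) = (1 - cis (t * x)) * of_real (x powr (- 2 * s) * \<phi> x)"
      unfolding f_def zpow_of_real[OF that] \<phi>_def by (simp add: cis_conv_exp mult_ac)
    then show ?thesis by simp
  qed
  have im: "Re (\<i> * f (\<i> * of_real l)) = (1 - exp (- (t * l))) * (\<mu> l / l\<^sup>2)" if "0 < l" for l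
  proof -
    define w where "w = zpow (\<i> * of_real l)"
    have w: "1 + w \<noteq> 0" unfolding w_def by (intro norm_one_plus_zpow quadrant_line that)
    have "f (\<i> * of_real l) = (1 - of_real (exp (- (t * l)))) * w / (- (of_real l)\<^sup>2 * (1 + w))"
      unfolding f_def w_def by (simp add: exp_of_real[symmetric] power_mult_distrib mult_ac)
    then have "\<i> * f (\<i> * of_real l) = of_real ((1 - exp (- (t * l))) / l\<^sup>2) * (- \<i> * (w / (1 + w)))"
      by (simp add: mult_ac)
    \<comment> \<open>After multiplication by \<open>- \<i>\<close>, the constant 1 contributes only
      an imaginary part; what remains is exactly the expression whose real part is
      \<open>\<mu>\<close>.\<close>
    also have "w / (1 + w) = 1 - 1 / (1 + w)" using w by (simp add: field_simps)
    also have "- \<i> * (1 - 1 / (1 + w)) = - \<i> + \<i> / (1 + w)" by (simp add: algebra_simps)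
    finally show ?thesis using Re_ii_inverse[OF that, folded w_def] by simp
  qed
  show ?thesis
  proof (rule Lim_transform_eventually[OF tendsto_integral_quadrant[OF f far near]])
    show "\<forall>\<^sub>F R in at_top. integral {1/R..R} (\<lambda>x. Re (f (of_real x))) - integral {1/R..R} (\<lambda>l. Re (\<i> * f (\<i> * of_real l))) =
       integral {1/R..R} (\<lambda>x. (1 - cos (t * x)) * (x powr (- 2 * s) * \<phi> x)) -
      integral {1/R..R} (\<lambda>l. (1 - exp (- (t * l))) * (\<mu> l / l\<^sup>2))"
      using eventually_gt_at_top[of 0]
    proof eventually_elim
      case (elim R)
      then have "0 < x" if "x \<in> {1/R..R}" for x 
        using that by (meson atLeastAtMost_iff divide_pos_pos less_le_trans zero_less_one)
      then show ?case
        by (intro arg_cong2[where f = "(-)"] integral_cong re im) auto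
    qed
  qed
qed

end

section \<open>The one-dimensional fundamental solution\<close>

text \<open>Dominated convergence for the difference quotients. Convexity of \<open>U\<close> lets
  the mean value inequality turn the uniform bound on the derivative into a bound on every
  quotient.\<close>

lemma has_real_derivative_set_integral:
  fixes f f' :: "real \<Rightarrow> 'b \<Rightarrow> real"
  assumes U: "open U" "convex U" "x \<in> U"
    and f: "\<And>y. y \<in> U \<Longrightarrow> set_integrable M A (f y)"
    and f': "\<And>y l. y \<in> U \<Longrightarrow> l \<in> A \<Longrightarrow> ((\<lambda>y. f y l) has_real_derivative f' y l) (at y)"
    and bound: "\<And>y l. y \<in> U \<Longrightarrow> l \<in> A \<Longrightarrow> \<bar>f' y l\<bar> \<le> w l"
    and w: "set_integrable M A w"
    and meas: "set_borel_measurable M A (f' x)"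
  shows "((\<lambda>y. LINT l:A|M. f y l) has_real_derivative (LINT l:A|M. f' x l)) (at x)"
proof -
  have "((\<lambda>y. ((LINT l:A|M. f y l) - (LINT l:A|M. f x l)) / (y - x)) \<longlongrightarrow> (LINT l:A|M. f' x l)) (at x within U)"
    unfolding tendsto_at_iff_sequentially comp_def
  proof (intro allI impI)
    fix X assume X: "\<forall>i. X i \<in> U - {x}" "X \<longlonglongrightarrow> x"
    then have XU: "X i \<in> U" "X i \<noteq> x" for i by auto
    have eq: "((LINT l:A|M. f (X i) l) - (LINT l:A|M. f x l)) / (X i - x)
        = (LINT l|M. indicator A l *\<^sub>R ((f (X i) l - f x l) / (X i - x)))" for i
      unfolding set_integral_diff(2)[OF f f, OF XU(1) U(3), symmetric] set_integral_divide_zero[symmetric]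
      by (simp only: set_lebesgue_integral_def)
    show "(\<lambda>i. ((LINT l:A|M. f (X i) l) - (LINT l:A|M. f x l)) / (X i - x)) \<longlonglongrightarrow> (LINT l:A|M. f' x l)"
      unfolding eq unfolding set_lebesgue_integral_def
    proof (rule integral_dominated_convergence[where w = "\<lambda>l. indicator A l *\<^sub>R w l"])
      show "(\<lambda>l. indicat_real A l *\<^sub>R f' x l) \<in> borel_measurable M"
        using meas by (simp add: set_borel_measurable_def)
      show "integrable M (\<lambda>l. indicat_real A l *\<^sub>R w l)"
        using w by (simp add: set_integrable_def)
      show "(\<lambda>l. indicat_real A l *\<^sub>R ((f (X i) l - f x l) / (X i - x))) \<in> borel_measurable M" for i
        using set_integrable_divide[OF set_integral_diff(1)[OF f f, OF XU(1) U(3)]]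
        by (auto simp: set_integrable_def dest!: borel_measurable_integrable)
      show "AE l in M. (\<lambda>i. indicat_real A l *\<^sub>R ((f (X i) l - f x l) / (X i - x))) \<longlonglongrightarrow> indicat_real A l *\<^sub>R f' x l"
      proof (rule AE_I2)
        fix l
        show "(\<lambda>i. indicat_real A l *\<^sub>R ((f (X i) l - f x l) / (X i - x))) \<longlonglongrightarrow> indicat_real A l *\<^sub>R f' x l"
        proof (cases "l \<in> A")
          case True
          from f'[OF U(3) True] have "((\<lambda>y. (f y l - f x l) / (y - x)) \<longlongrightarrow> f' x l) (at x)"
            by (simp add: has_field_derivative_iff)
          then have "(\<lambda>i. (f (X i) l - f x l) / (X i - x)) \<longlonglongrightarrow> f' x l"
            using X by (auto simp: tendsto_at_iff_sequentially comp_def)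
          then show ?thesis using True by simp
        qed simp
      qed
      show "AE l in M. norm (indicat_real A l *\<^sub>R ((f (X i) l - f x l) / (X i - x))) \<le> indicat_real A l *\<^sub>R w l" for i
      proof (rule AE_I2)
        fix l
        show "norm (indicat_real A l *\<^sub>R ((f (X i) l - f x l) / (X i - x))) \<le> indicat_real A l *\<^sub>R w l"
        proof (cases "l \<in> A")
          case True
          have "norm (f (X i) l - f x l) \<le> w l * norm (X i - x)"
          proof (rule field_differentiable_bound[OF U(2)])
            show "((\<lambda>y. f y l) has_real_derivative f' z l) (at z within U)" if "z \<in> U" for z
              using f'[OF that True] by (rule has_field_derivative_at_within)
          qed (use bound True XU U in auto)
          then show ?thesis using True XU(2)[of i] by (simp add: abs_divide divide_le_eq)
        qed simp
      qed
    qed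
  qed
  then show ?thesis
    unfolding has_field_derivative_iff at_within_open[OF U(3,1)] .
qed

lemma tendsto_integral_exhaust_Ioi:
  fixes f :: "real \<Rightarrow> real"
  assumes f: "set_integrable lborel {0<..} f"
  shows "((\<lambda>R. integral {1/R..R} f) \<longlongrightarrow> (LINT x:{0<..}|lborel. f x)) at_top"
proof -
  have "((\<lambda>R. LINT x|lborel. indicator {1/R..R} x *\<^sub>R (indicator {0<..} x *\<^sub>R f x)) \<longlongrightarrow> (LINT x|lborel. indicator {0<..} x *\<^sub>R f x)) at_top"
  proof (rule integral_dominated_convergence_at_top[where w = "\<lambda>x. norm (indicator {0<..} x *\<^sub>R f x)"])
    have int: "integrable lborel (\<lambda>x. indicator {0<..} x *\<^sub>R f x)"
      using f unfolding set_integrable_def .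
    show "integrable lborel (\<lambda>x. norm (indicat_real {0<..} x *\<^sub>R f x))"
      using int by (rule integrable_norm)
    show [measurable]: "(\<lambda>x. indicator {0<..} x *\<^sub>R f x) \<in> borel_measurable lborel"
      using int by (rule borel_measurable_integrable)
    show "(\<lambda>x. indicator {1/R..R} x *\<^sub>R (indicator {0<..} x *\<^sub>R f x)) \<in> borel_measurable lborel" for R :: real
      by measurable
    show "\<forall>\<^sub>F R in at_top. AE x in lborel. norm (indicator {1/R..R} x *\<^sub>R (indicator {0<..} x *\<^sub>R f x))
        \<le> norm (indicat_real {0<..} x *\<^sub>R f x)"
      by (auto simp: indicator_def)
    show "AE x in lborel. ((\<lambda>R. indicat_real {1 / R..R} x *\<^sub>R indicat_real {0<..} x *\<^sub>R f x) \<longlongrightarrow>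
              indicat_real {0<..} x *\<^sub>R f x) at_top"
    proof (rule AE_I2)
      fix x :: real
      show "((\<lambda>R. indicat_real {1 / R..R} x *\<^sub>R indicat_real {0<..} x *\<^sub>R f x) \<longlongrightarrow>
              indicat_real {0<..} x *\<^sub>R f x) at_top"
      proof (cases "0 < x")
        case True
        show ?thesis
        proof (rule tendsto_eventually)
          show "\<forall>\<^sub>F R in at_top. indicat_real {1 / R..R} x *\<^sub>R indicat_real {0<..} x *\<^sub>R f x = indicat_real {0<..} x *\<^sub>R f x"
            using eventually_ge_at_top[of "max x (1/x)"]
          proof eventually_elim
            case (elim R)
            then have "1 / R \<le> x" "x \<le> R" using True by (auto simp: field_simps)
            then show ?case by simp
          qed
        qed
      qed simp
    qed
  qed
  moreover have "\<forall>\<^sub>F R in at_top. (LINT x|lborel. indicator {1/R..R} x *\<^sub>R (indicator {0<..} x *\<^sub>R f x)) = integral {1/R..R} f"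
    using eventually_gt_at_top[of 0]
  proof eventually_elim
    case (elim R)
    then have sub: "{1/R..R} \<subseteq> {0<..}" by (auto intro: less_le_trans[rotated])
    have "(LINT x|lborel. indicator {1/R..R} x *\<^sub>R (indicator {0<..} x *\<^sub>R f x)) = (LINT x:{1/R..R}|lborel. f x)"
      unfolding set_lebesgue_integral_def
      using sub by (intro Bochner_Integration.integral_cong) (auto simp: indicator_def)
    also have "\<dots> = integral {1/R..R} f"
      by (intro set_borel_integral_eq_integral set_integrable_subset[OF f]) (use sub in auto)
    finally show ?case .
  qed
  ultimately show ?thesis
    unfolding set_lebesgue_integral_def by (rule Lim_transform_eventually)
qed

text \<open>A zero integral would force \<open>f\<close> to vanish almost everywhere, hence make the
  unit interval a null set.\<close>

lemma set_integral_pos_Ioi: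
  fixes f :: "real \<Rightarrow> real"
  assumes f: "set_integrable lborel {0<..} f" and pos: "\<And>x. 0 < x \<Longrightarrow> 0 < f x"
  shows "0 < (LINT x:{0<..}|lborel. f x)"
proof -
  have int: "integrable lborel (\<lambda>x. indicator {0<..} x *\<^sub>R f x)" using f unfolding set_integrable_def .
  have nn: "AE x in lborel. 0 \<le> indicator {0<..} x *\<^sub>R f x"
    using pos by (auto simp: indicator_def intro: less_imp_le)
  have "(LINT x:{0<..}|lborel. f x) \<noteq> 0"
  proof
    assume "(LINT x:{0<..}|lborel. f x) = 0"
    then have "AE x in lborel. indicator {0<..} x *\<^sub>R f x = 0"
      using integral_nonneg_eq_0_iff_AE[OF int nn] by (simp add: set_lebesgue_integral_def)
    then have "AE x in lborel. x \<notin> {0<..<1::real}"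
      by eventually_elim (use pos in \<open>force simp: indicator_def\<close>)
    moreover have "{x \<in> space lborel. \<not> x \<notin> {0<..<1::real}} = {0<..<1}" by auto
    ultimately have "emeasure lborel {0<..<1::real} = 0"
      using AE_iff_measurable[of "{0<..<1::real}" lborel "\<lambda>x. x \<notin> {0<..<1}"] by simp
    then show False by simp
  qed
  moreover have "0 \<le> (LINT x:{0<..}|lborel. f x)"
    unfolding set_lebesgue_integral_def using nn by (rule integral_nonneg_AE)
  ultimately show ?thesis by simp
qed

text \<open>One term of the exponential series at \<open>t * x\<close> is at most its sum.\<close>

lemma power_mult_exp_le:
  fixes x t :: real
  assumes "0 \<le> x" "0 < t"
  shows "x ^ n * exp (- (t * x)) \<le> fact n / t ^ n"
proof -
  have "(\<Sum>k\<in>{n}. (t * x) ^ k /\<^sub>R fact k) \<le> (\<Sum>k. (t * x) ^ k /\<^sub>R fact k)"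
    using assms by (intro sum_le_suminf summable_exp_generic) auto
  then have "(t * x) ^ n / fact n \<le> exp (t * x)"
    by (simp add: exp_def divide_inverse mult.commute)
  then have "(t * x) ^ n * exp (- (t * x)) \<le> fact n"
    by (simp add: exp_minus field_simps)
  then show ?thesis using assms by (simp add: power_mult_distrib field_simps)
qed

text \<open>Interpolation between the trivial bound 2, for distant arguments, and the Lipschitz
  bound, for arguments at distance at most 1.\<close>

lemma abs_cos_diff_le:
  fixes a b r :: real
  assumes "0 < r" "r < 1"
  shows "\<bar>cos a - cos b\<bar> \<le> 2 * \<bar>a - b\<bar> powr r"
proof -
  have 1: "\<bar>cos a - cos b\<bar> \<le> 2"
    using abs_cos_le_one[of a] abs_cos_le_one[of b] by linarith
  have "norm (cos a - cos b) \<le> 1 * norm (a - b)"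
    by (rule field_differentiable_bound[of UNIV cos "\<lambda>x. - sin x"])
       (auto intro!: derivative_eq_intros)
  then have 2: "\<bar>cos a - cos b\<bar> \<le> \<bar>a - b\<bar>" by simp
  show ?thesis
  proof (cases "\<bar>a - b\<bar> \<le> 1")
    case True
    then have "\<bar>a - b\<bar> \<le> \<bar>a - b\<bar> powr r"
      using powr_mono'[of r 1 "\<bar>a - b\<bar>"] assms by (cases "a = b") auto
    then show ?thesis using 2 powr_ge_zero[of "\<bar>a - b\<bar>" r] by linarith
  next
    case False
    then have "1 \<le> \<bar>a - b\<bar> powr r" using assms by (intro ge_one_powr_ge_zero) auto
    then show ?thesis using 1 by linarith
  qed
qed

section \<open>Regularity, Laplace representation and strict concavity of \<open>F\<close>; the
  truncated cosine integral\<close>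

context frac_order
begin

definition F :: "real \<Rightarrow> real" where
  "F t = (LINT x:{0<..}|lborel. (1 - cos (t * x)) * (x powr (- 2 * s) * \<phi> x))"

text \<open>For \<open>k \<ge> 1\<close> and \<open>t > 0\<close> this is the \<open>k\<close>-th derivative of \<open>F\<close> up to the sign \<open>(-1)^(k-1)\<close>;
  \<open>D 0\<close> diverges when \<open>s \<ge> 1/2\<close>.\<close>

definition D :: "nat \<Rightarrow> real \<Rightarrow> real" where
  "D k t = (LINT l:{0<..}|lborel. l ^ k * exp (- (t * l)) * (\<mu> l / l\<^sup>2))"

lemma integrable_powr_\<phi>: "set_integrable lborel {0<..} (\<lambda>x. x powr (- s) * \<phi> x)"
proof (rule set_integrable_powr_bounds[where \<alpha> = "- s" and \<beta> = "s - 2" and C = 1])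
  show "\<bar>x powr - s * \<phi> x\<bar> \<le> 1 * x powr - s" for x
    using \<phi>_nonneg[of x] \<phi>_le_1[of x] by (simp add: abs_mult mult_left_le)
  show "\<bar>x powr - s * \<phi> x\<bar> \<le> 1 * x powr (s - 2)" if "1 \<le> x" for x
  proof -
    have "x powr - s * \<phi> x \<le> x powr - s * x powr - (2 - 2 * s)"
      using \<phi>_le[of x "2 - 2 * s"] that s by (intro mult_left_mono) auto
    also have "\<dots> = x powr (s - 2)" by (simp add: powr_add[symmetric])
    finally show ?thesis using \<phi>_nonneg[of x] by simp
  qed
qed (use s in auto)

text \<open>The Hoelder estimate of the cosine with exponent \<open>s\<close> takes a factor
  \<open>x powr s\<close> from the frequency, which softens the singular weight
  \<open>x powr (- 2 * s)\<close> to an integrable one.\<close>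

lemma abs_cos_diff_weight_le:
  assumes "0 < x"
  shows "\<bar>cos (t * x) - cos (u * x)\<bar> * (x powr (- 2 * s) * \<phi> x) \<le> 2 * \<bar>t - u\<bar> powr s * (x powr (- s) * \<phi> x)"
proof -
  have "\<bar>cos (t * x) - cos (u * x)\<bar> \<le> 2 * \<bar>t * x - u * x\<bar> powr s"
    by (rule abs_cos_diff_le[OF s])
  also have "\<bar>t * x - u * x\<bar> = \<bar>t - u\<bar> * x"
    using assms by (simp add: left_diff_distrib[symmetric] abs_mult)
  finally have "\<bar>cos (t * x) - cos (u * x)\<bar> * (x powr (- 2 * s) * \<phi> x) \<le>
     2 * (\<bar>t - u\<bar> * x) powr s * (x powr (- 2 * s) * \<phi> x)"
    using \<phi>_nonneg by (intro mult_right_mono) auto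
  also have "\<dots> = 2 * \<bar>t - u\<bar> powr s * (x powr s * x powr (- 2 * s) * \<phi> x)"
    using assms by (simp add: powr_mult)
  also have "x powr s * x powr (- 2 * s) = x powr (- s)"
    by (simp add: powr_add[symmetric])
  finally show ?thesis .
qed

lemma integrable_cos_diff:
  "set_integrable lborel {0<..} (\<lambda>x. (cos (t * x) - cos (u * x)) * (x powr (- 2 * s) * \<phi> x))"
proof (rule set_integrable_bound[OF set_integrable_mult_right[OF integrable_powr_\<phi>, of "2 * \<bar>t - u\<bar> powr s"]])
  show "AE x in lborel. x \<in> {0<..} \<longrightarrow> norm ((cos (t * x) - cos (u * x)) * (x powr (- 2 * s) * \<phi> x))
     \<le> norm (2 * \<bar>t - u\<bar> powr s * (x powr - s * \<phi> x))"
    using abs_cos_diff_weight_le \<phi>_nonneg by (auto simp: abs_mult)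
qed (simp add: set_borel_measurable_def)

lemma integrable_F: "set_integrable lborel {0<..} (\<lambda>x. (1 - cos (t * x)) * (x powr (- 2 * s) * \<phi> x))"
  using integrable_cos_diff[of 0 t] by simp

text \<open>The exponent \<open>s\<close> meets every constraint at once: \<open>2 s - 1 < s\<close>
  for integrability at frequency 0, \<open>s < 1\<close> for integrability at infinity, and
  \<open>s < 2 s\<close> so that the resulting growth is admissible for the fractional
  Laplacian.\<close>

lemma F_holder: "\<exists>C. \<forall>t u. \<bar>F t - F u\<bar> \<le> C * \<bar>t - u\<bar> powr s"
proof (intro exI allI)
  fix t u
  have eq: "F t - F u = (LINT x:{0<..}|lborel. (cos (u * x) - cos (t * x)) * (x powr (- 2 * s) * \<phi> x))"
    unfolding F_def by (subst set_integral_diff(2)[OF integrable_F integrable_F, symmetric]) (simp add: algebra_simps)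
  have "\<bar>F t - F u\<bar> \<le> (LINT x:{0<..}|lborel. norm ((cos (u * x) - cos (t * x)) * (x powr (- 2 * s) * \<phi> x)))"
    unfolding eq using set_integral_norm_bound[OF integrable_cos_diff] by simp
  also have "\<dots> \<le> (LINT x:{0<..}|lborel. 2 * \<bar>t - u\<bar> powr s * (x powr (- s) * \<phi> x))"
  proof (rule set_integral_mono[OF set_integrable_norm[OF integrable_cos_diff] set_integrable_mult_right[OF integrable_powr_\<phi>]])
    show "norm ((cos (u * x) - cos (t * x)) * (x powr (- 2 * s) * \<phi> x)) \<le> 2 * \<bar>t - u\<bar> powr s * (x powr (- s) * \<phi> x)"
      if "x \<in> {0<..}" for x
    proof -
      have "norm ((cos (u * x) - cos (t * x)) * (x powr (- 2 * s) * \<phi> x)) =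
          \<bar>cos (u * x) - cos (t * x)\<bar> * (x powr (- 2 * s) * \<phi> x)"
        unfolding real_norm_def abs_mult by (simp only: abs_of_nonneg \<phi>_nonneg powr_ge_zero)
      also have "\<dots> \<le> 2 * \<bar>u - t\<bar> powr s * (x powr (- s) * \<phi> x)"
        using that by (intro abs_cos_diff_weight_le) auto
      also have "\<bar>u - t\<bar> = \<bar>t - u\<bar>" by (rule abs_minus_commute)
      finally show ?thesis .
    qed
  qed
  also have "\<dots> = 2 * (LINT x:{0<..}|lborel. x powr (- s) * \<phi> x) * \<bar>t - u\<bar> powr s"
    unfolding set_integral_mult_right by (simp only: mult_ac)
  finally show "\<bar>F t - F u\<bar> \<le> 2 * (LINT x:{0<..}|lborel. x powr (- s) * \<phi> x) * \<bar>t - u\<bar> powr s" .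
qed

lemma F_0: "F 0 = 0"
  by (simp add: F_def)

lemma F_minus: "F (- t) = F t"
  by (simp add: F_def)

lemma F_growth: "\<exists>C\<ge>0. \<forall>t. \<bar>F t\<bar> \<le> C * \<bar>t\<bar> powr s"
proof -
  obtain C where C: "\<And>t u. \<bar>F t - F u\<bar> \<le> C * \<bar>t - u\<bar> powr s" using F_holder by blast
  have "0 \<le> C" using C[of 1 0] by auto
  moreover have "\<bar>F t\<bar> \<le> C * \<bar>t\<bar> powr s" for t using C[of t 0] by (simp add: F_0)
  ultimately show ?thesis by blast
qed

lemma continuous_F: "continuous_on UNIV F"
proof -
  obtain C where C: "\<And>t u. \<bar>F t - F u\<bar> \<le> C * \<bar>t - u\<bar> powr s" using F_holder by blast
  have "(F \<longlongrightarrow> F t) (at t)" for t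
  proof (rule LIM_zero_cancel, rule Lim_null_comparison)
    show "\<forall>\<^sub>F u in at t. norm (F u - F t) \<le> C * \<bar>u - t\<bar> powr s" using C by simp
    have "((\<lambda>u. C * \<bar>u - t\<bar> powr s) \<longlongrightarrow> C * \<bar>t - t\<bar> powr s) (at t)"
      using s by (intro tendsto_intros tendsto_powr') auto
    then show "((\<lambda>u. C * \<bar>u - t\<bar> powr s) \<longlongrightarrow> 0) (at t)" by simp
  qed
  then show ?thesis by (simp add: continuous_on_def)
qed

text \<open>The common majorant of all Laplace integrals below. Its exponents \<open>1 - 2 s\<close>
  at 0 and \<open>2 s - 3\<close> at infinity lie on the right sides of \<open>-1\<close>, both
  because \<open>s < 1\<close>.\<close>

lemma integrable_\<mu>_div: "set_integrable lborel {0<..} (\<lambda>l. \<mu> l / l)"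
proof (rule set_integrable_powr_bounds[where \<alpha> = "1 - 2 * s" and \<beta> = "2 * s - 3" and C = "1 / sin (pi * s)"])
  show "\<bar>\<mu> l / l\<bar> \<le> 1 / sin (pi * s) * l powr (1 - 2 * s)" if "0 < l" for l
  proof -
    have "\<bar>\<mu> l / l\<bar> = \<mu> l / l" using that \<mu>_nonneg by simp
    also have "\<dots> \<le> (l powr (2 - 2 * s) / sin (pi * s)) / l"
      using that by (intro divide_right_mono \<mu>_le) auto
    also have "\<dots> = 1 / sin (pi * s) * l powr (1 - 2 * s)"
      using that powr_diff[of l "2 - 2 * s" 1] by simp
    finally show ?thesis .
  qed
  show "\<bar>\<mu> l / l\<bar> \<le> 1 / sin (pi * s) * l powr (2 * s - 3)" if "1 \<le> l" for l
  proof -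
    have "\<bar>\<mu> l / l\<bar> = \<mu> l / l" using that \<mu>_nonneg by simp
    also have "\<dots> \<le> (l powr (2 * s - 2) / sin (pi * s)) / l"
      using that by (intro divide_right_mono \<mu>_le) auto
    also have "\<dots> = 1 / sin (pi * s) * l powr (2 * s - 3)"
      using that powr_diff[of l "2 * s - 2" 1] by simp
    finally show ?thesis .
  qed
qed (use s in auto)

text \<open>One power of \<open>l\<close> is spent on reducing \<open>\<mu> l / l\<^sup>2\<close> to
  the integrable \<open>\<mu> l / l\<close>; the exponential absorbs the other
  \<open>k\<close>.\<close>

lemma laplace_weight_le:
  assumes "0 < t" "0 < l"
  shows "l ^ Suc k * exp (- (t * l)) * (\<mu> l / l\<^sup>2) \<le> fact k / t ^ k * (\<mu> l / l)"
proof -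
  have "l ^ Suc k * exp (- (t * l)) * (\<mu> l / l\<^sup>2) = l ^ k * exp (- (t * l)) * (\<mu> l / l)"
    using assms by (simp add: power2_eq_square)
  also have "\<dots> \<le> fact k / t ^ k * (\<mu> l / l)"
    using assms \<mu>_nonneg by (intro mult_right_mono power_mult_exp_le) auto
  finally show ?thesis .
qed

lemma integrable_D:
  assumes "0 < t"
  shows "set_integrable lborel {0<..} (\<lambda>l. l ^ Suc k * exp (- (t * l)) * (\<mu> l / l\<^sup>2))"
proof (rule set_integrable_bound[OF set_integrable_mult_right[OF integrable_\<mu>_div, of "fact k / t ^ k"]])
  show "AE x in lborel. x \<in> {0<..} \<longrightarrow> norm (x ^ Suc k * exp (- (t * x)) * (\<mu> x / x\<^sup>2)) \<le> norm (fact k / t ^ k * (\<mu> x / x))"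
    using laplace_weight_le[OF assms] \<mu>_nonneg assms by (auto simp: abs_mult)
qed (simp add: set_borel_measurable_def)

lemma integrable_laplace_F:
  assumes "0 < t"
  shows "set_integrable lborel {0<..} (\<lambda>l. (1 - exp (- (t * l))) * (\<mu> l / l\<^sup>2))"
proof (rule set_integrable_bound[OF set_integrable_mult_right[OF integrable_\<mu>_div, of t]])
  have "(1 - exp (- (t * x))) * (\<mu> x / x\<^sup>2) \<le> (t * x) * (\<mu> x / x\<^sup>2)" if "0 < x" for x
    using \<mu>_nonneg[of x] that exp_ge_add_one_self[of "- (t * x)"] by (intro mult_right_mono) auto
  then show "AE x in lborel. x \<in> {0<..} \<longrightarrow> norm ((1 - exp (- (t * x))) * (\<mu> x / x\<^sup>2)) \<le> norm (t * (\<mu> x / x))"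
    using \<mu>_nonneg assms by (auto simp: abs_mult power2_eq_square)
qed (simp add: set_borel_measurable_def)

text \<open>Both integrals converge absolutely, so the vanishing difference of their truncations
  becomes an equality of limits.\<close>

lemma F_laplace:
  assumes "0 < t"
  shows "F t = (LINT l:{0<..}|lborel. (1 - exp (- (t * l))) * (\<mu> l / l\<^sup>2))"
proof -
  have "((\<lambda>R. integral {1/R..R} (\<lambda>x. (1 - cos (t * x)) * (x powr (- 2 * s) * \<phi> x)) -
      integral {1/R..R} (\<lambda>l. (1 - exp (- (t * l))) * (\<mu> l / l\<^sup>2))) \<longlongrightarrow>
      F t - (LINT l:{0<..}|lborel. (1 - exp (- (t * l))) * (\<mu> l / l\<^sup>2))) at_top"
    unfolding F_def
    by (intro tendsto_diff tendsto_integral_exhaust_Ioi integrable_F integrable_laplace_F assms)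
  from tendsto_unique[OF _ this tendsto_integral_one_minus_cos[OF assms]] show ?thesis by simp
qed

lemma laplace_weight_mono:
  assumes "t \<le> y" "0 < l"
  shows "\<bar>l ^ k * exp (- (y * l)) * (\<mu> l / l\<^sup>2)\<bar> \<le> l ^ k * exp (- (t * l)) * (\<mu> l / l\<^sup>2)"
proof -
  have "\<bar>l ^ k * exp (- (y * l)) * (\<mu> l / l\<^sup>2)\<bar> = l ^ k * exp (- (y * l)) * (\<mu> l / l\<^sup>2)"
    using assms \<mu>_nonneg by (intro abs_of_nonneg mult_nonneg_nonneg divide_nonneg_nonneg) auto
  also have "\<dots> \<le> l ^ k * exp (- (t * l)) * (\<mu> l / l\<^sup>2)"
    using assms \<mu>_nonneg by (intro mult_right_mono mult_left_mono divide_nonneg_nonneg) auto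
  finally show ?thesis .
qed

lemma D_derivative:
  assumes "0 < t"
  shows "(D (Suc k) has_real_derivative - D (Suc (Suc k)) t) (at t)"
proof -
  have *: "((\<lambda>y. l ^ Suc k * exp (- (y * l)) * c) has_real_derivative - (l ^ Suc (Suc k) * exp (- (y * l)) * c)) (at y)"
    for l y c :: real
    by (auto intro!: derivative_eq_intros)
  have "(D (Suc k) has_real_derivative
     (LINT l:{0<..}|lborel. - (l ^ Suc (Suc k) * exp (- (t * l)) * (\<mu> l / l\<^sup>2)))) (at t)"
    unfolding D_def
  \<comment> \<open>On this half-line the exponential weight is largest at the left end, so its
    value at \<open>t / 2\<close> dominates, and it is integrable because
    \<open>t / 2 > 0\<close>.\<close>
  proof (rule has_real_derivative_set_integral[where U = "{t/2<..}" and
        w = "\<lambda>l. l ^ Suc (Suc k) * exp (- (t / 2 * l)) * (\<mu> l / l\<^sup>2)", OF _ _ _ _ *])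
    show "\<bar>- (l ^ Suc (Suc k) * exp (- (y * l)) * (\<mu> l / l\<^sup>2))\<bar> \<le> l ^ Suc (Suc k) * exp (- (t / 2 * l)) * (\<mu> l / l\<^sup>2)"
      if "y \<in> {t/2<..}" "l \<in> {0<..}" for y l
      unfolding abs_minus_cancel by (rule laplace_weight_mono) (use that in auto)
    show "set_integrable lborel {0<..} (\<lambda>l. l ^ Suc k * exp (- (y * l)) * (\<mu> l / l\<^sup>2))" if "y \<in> {t/2<..}" for y
      using that assms by (intro integrable_D) auto
    show "set_integrable lborel {0<..} (\<lambda>l. l ^ Suc (Suc k) * exp (- (t / 2 * l)) * (\<mu> l / l\<^sup>2))"
      using assms by (intro integrable_D) auto
    show "set_borel_measurable lborel {0<..} (\<lambda>l. - (l ^ Suc (Suc k) * exp (- (t * l)) * (\<mu> l / l\<^sup>2)))"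
      unfolding set_borel_measurable_def by measurable
  qed (use assms in auto)
  then show ?thesis unfolding set_integral_uminus[OF integrable_D[OF assms]] D_def .
qed

lemma F_derivative:
  assumes "0 < t"
  shows "(F has_real_derivative D 1 t) (at t)"
proof -
  have *: "((\<lambda>y. (1 - exp (- (y * l))) * c) has_real_derivative (l ^ Suc 0 * exp (- (y * l)) * c)) (at y)"
    for l y c :: real
    by (auto intro!: derivative_eq_intros)
  have "((\<lambda>t. LINT l:{0<..}|lborel. (1 - exp (- (t * l))) * (\<mu> l / l\<^sup>2)) has_real_derivative
     (LINT l:{0<..}|lborel. l ^ Suc 0 * exp (- (t * l)) * (\<mu> l / l\<^sup>2))) (at t)"
  proof (rule has_real_derivative_set_integral[where U = "{t/2<..}" and
        w = "\<lambda>l. l ^ Suc 0 * exp (- (t / 2 * l)) * (\<mu> l / l\<^sup>2)", OF _ _ _ _ *])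
    show "\<bar>l ^ Suc 0 * exp (- (y * l)) * (\<mu> l / l\<^sup>2)\<bar> \<le> l ^ Suc 0 * exp (- (t / 2 * l)) * (\<mu> l / l\<^sup>2)"
      if "y \<in> {t/2<..}" "l \<in> {0<..}" for y l
      by (rule laplace_weight_mono) (use that in auto)
    show "set_integrable lborel {0<..} (\<lambda>l. (1 - exp (- (y * l))) * (\<mu> l / l\<^sup>2))" if "y \<in> {t/2<..}" for y
      using that assms by (intro integrable_laplace_F) auto
    show "set_integrable lborel {0<..} (\<lambda>l. l ^ Suc 0 * exp (- (t / 2 * l)) * (\<mu> l / l\<^sup>2))"
      using assms by (intro integrable_D) auto
    show "set_borel_measurable lborel {0<..} (\<lambda>l. l ^ Suc 0 * exp (- (t * l)) * (\<mu> l / l\<^sup>2))"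
      unfolding set_borel_measurable_def by measurable
  qed (use assms in auto)
  then have "((\<lambda>t. LINT l:{0<..}|lborel. (1 - exp (- (t * l))) * (\<mu> l / l\<^sup>2)) has_real_derivative D 1 t) (at t)"
    unfolding D_def One_nat_def .
  then show ?thesis
    by (rule has_field_derivative_transform_within_open[of _ _ _ "{0<..}"]) (use assms F_laplace in auto)
qed

text \<open>Strict convexity of the exponential under the Laplace integral: the second difference of
  \<open>exp (- t * l)\<close> is \<open>exp (- (p * l))\<close> times the square of
  \<open>2 sinh (u * l / 2)\<close>, and the weight \<open>\<mu>\<close> is positive.\<close>

lemma F_strictly_concave:
  assumes "u \<noteq> 0" "\<bar>u\<bar> < p"
  shows "F (p - u) + F (p + u) < 2 * F p"
proof -
  have p: "0 < p" "0 < p - u" "0 < p + u" using assms by auto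
  let ?f = "\<lambda>t l. (1 - exp (- (t * l))) * (\<mu> l / l\<^sup>2)"
  note I = integrable_laplace_F[OF p(1)] integrable_laplace_F[OF p(2)] integrable_laplace_F[OF p(3)]
  have J: "set_integrable lborel {0<..} (\<lambda>l. 2 * ?f p l)"
    using I(1) by (intro set_integrable_mult_right)
  have "0 < (LINT l:{0<..}|lborel. 2 * ?f p l - (?f (p - u) l + ?f (p + u) l))"
  proof (rule set_integral_pos_Ioi)
    show "set_integrable lborel {0<..} (\<lambda>l. 2 * ?f p l - (?f (p - u) l + ?f (p + u) l))"
      by (intro set_integral_diff(1) set_integral_add(1) I J)
    fix l :: real assume l: "0 < l"
    have "exp (- ((p - u) * l)) + exp (- ((p + u) * l)) - 2 * exp (- (p * l))
        = exp (- (p * l)) * (exp (u * l / 2) - exp (- (u * l / 2)))\<^sup>2"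
      by (simp add: power2_eq_square exp_add[symmetric] algebra_simps)
    moreover have "exp (u * l / 2) \<noteq> exp (- (u * l / 2))" using l assms by simp
    ultimately have "0 < exp (- ((p - u) * l)) + exp (- ((p + u) * l)) - 2 * exp (- (p * l))" by simp
    then have "0 < (exp (- ((p - u) * l)) + exp (- ((p + u) * l)) - 2 * exp (- (p * l))) * (\<mu> l / l\<^sup>2)"
      using l \<mu>_pos by simp
    also have "\<dots> = 2 * ?f p l - (?f (p - u) l + ?f (p + u) l)" by (simp only: algebra_simps)
    finally show "0 < 2 * ?f p l - (?f (p - u) l + ?f (p + u) l)" .
  qed
  also have "\<dots> = 2 * F p - (F (p - u) + F (p + u))"
    unfolding F_laplace[OF p(1)] F_laplace[OF p(2)] F_laplace[OF p(3)]
      set_integral_diff(2)[OF J set_integral_add(1)[OF I(2,3)]] set_integral_add(2)[OF I(2,3)]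
      set_integral_mult_right ..
  finally show ?thesis by simp
qed

text \<open>The cosine transform of \<open>\<phi>\<close> with a frequency cutoff. The cutoff is
  kept because \<open>\<phi>\<close> itself is not integrable at infinity when
  \<open>s \<ge> 1/2\<close>.\<close>

definition \<Phi> :: "real \<Rightarrow> real \<Rightarrow> real" where
  "\<Phi> t M = (LINT x:{0<..M}|lborel. cos (t * x) * \<phi> x)"

lemma set_integrable_one: "set_integrable lborel {0<..M::real} (\<lambda>_. 1 :: real)"
proof -
  have "bounded {0<..M}"
    by (rule bounded_subset[OF compact_imp_bounded[OF compact_Icc[of 0 M]]]) auto
  from emeasure_bounded_finite[OF this] have "integrable lborel (indicator {0<..M} :: real \<Rightarrow> real)"
    by (intro integrable_real_indicator) auto
  then show ?thesis by (simp add: set_integrable_def)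
qed

lemma integrable_cos_\<phi>: "set_integrable lborel {0<..M} (\<lambda>x. cos (t * x) * \<phi> x)"
proof (rule set_integrable_bound[of lborel _ "\<lambda>x. 1 :: real"])
  show "AE x in lborel. x \<in> {0<..M} \<longrightarrow> norm (cos (t * x) * \<phi> x) \<le> norm (1::real)"
    using \<phi>_nonneg \<phi>_le_1 abs_cos_le_one by (auto simp: abs_mult intro!: mult_le_one)
qed (auto simp: set_borel_measurable_def intro: set_integrable_one)

lemma \<Phi>_bound: "0 \<le> M \<Longrightarrow> \<bar>\<Phi> t M\<bar> \<le> M"
proof -
  assume M: "0 \<le> M"
  have "\<bar>\<Phi> t M\<bar> \<le> (LINT x:{0<..M}|lborel. norm (cos (t * x) * \<phi> x))"
    unfolding \<Phi>_def using set_integral_norm_bound[OF integrable_cos_\<phi>] by simp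
  also have "\<dots> \<le> (LINT x:{0<..M}|lborel. 1)"
  proof (intro set_integral_mono set_integrable_norm integrable_cos_\<phi>)
    show "norm (cos (t * x) * \<phi> x) \<le> 1" for x
      using \<phi>_nonneg \<phi>_le_1 abs_cos_le_one by (auto simp: abs_mult intro!: mult_le_one)
  qed (rule set_integrable_one)
  also have "\<dots> = M" using M by (simp add: set_lebesgue_integral_def)
  finally show ?thesis .
qed

text \<open>The rotated integral converges absolutely to \<open>D 2\<close>, so the contour identity
  forces the real-axis integral to converge as well. The missing piece up to \<open>1/R\<close> is
  negligible because \<open>\<phi> \<le> 1\<close>.\<close>

lemma tendsto_\<Phi>:
  assumes "t \<noteq> 0"
  shows "(\<Phi> t \<longlongrightarrow> D 2 \<bar>t\<bar>) at_top"
proof -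
  let ?t = "\<bar>t\<bar>"
  have even: "cos (t * x) = cos (?t * x)" for x by (cases "0 \<le> t") auto
  have int: "set_integrable lborel {0<..} (\<lambda>l. exp (- (?t * l)) * \<mu> l)"
  proof -
    have "set_integrable lborel {0<..} (\<lambda>l. exp (- (?t * l)) * \<mu> l) =
        set_integrable lborel {0<..} (\<lambda>l. l ^ Suc 1 * exp (- (?t * l)) * (\<mu> l / l\<^sup>2))"
      by (rule set_integrable_cong) (auto simp: power2_eq_square)
    then show ?thesis using integrable_D[of ?t 1] assms by simp
  qed
  have D: "(LINT l:{0<..}|lborel. exp (- (?t * l)) * \<mu> l) = D 2 ?t"
    unfolding D_def by (rule set_lebesgue_integral_cong) auto
  have "((\<lambda>R. (integral {1/R..R} (\<lambda>x. cos (?t * x) * \<phi> x) -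
      integral {1/R..R} (\<lambda>l. exp (- (?t * l)) * \<mu> l)) + integral {1/R..R} (\<lambda>l. exp (- (?t * l)) * \<mu> l)) \<longlongrightarrow> 0 + D 2 ?t) at_top"
    unfolding D[symmetric] using assms
    by (intro tendsto_add tendsto_integral_cos_\<phi> tendsto_integral_exhaust_Ioi int) auto
  then have 1: "((\<lambda>R. integral {1/R..R} (\<lambda>x. cos (t * x) * \<phi> x)) \<longlongrightarrow> D 2 ?t) at_top"
    by (simp add: even)
  have 2: "((\<lambda>R. \<Phi> t (1 / R)) \<longlongrightarrow> 0) at_top"
  proof (rule Lim_null_comparison)
    show "\<forall>\<^sub>F R in at_top. norm (\<Phi> t (1 / R)) \<le> 1 / R"
      using eventually_gt_at_top[of 0] by eventually_elim (use \<Phi>_bound in auto)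
    show "((\<lambda>R::real. 1 / R) \<longlongrightarrow> 0) at_top" by real_asymp
  qed
  have "((\<lambda>R. \<Phi> t (1 / R) + integral {1/R..R} (\<lambda>x. cos (t * x) * \<phi> x)) \<longlongrightarrow> 0 + D 2 ?t) at_top"
    by (intro tendsto_add 1 2)
  moreover have "\<forall>\<^sub>F R in at_top. \<Phi> t (1 / R) + integral {1/R..R} (\<lambda>x. cos (t * x) * \<phi> x) = \<Phi> t R"
    using eventually_gt_at_top[of 1]
  proof eventually_elim
    case (elim R)
    then have R: "0 < 1 / R" "1 / R \<le> R" by (auto simp: divide_le_eq intro: order_trans[of 1 "R * 1"] mult_mono)
    have sub: "set_integrable lborel {1/R..R} (\<lambda>x. cos (t * x) * \<phi> x)"
      by (rule set_integrable_subset[OF integrable_cos_\<phi>[of R]]) (auto intro: less_le_trans[OF R(1)])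
    have eq: "{0<..R} = {0<..1/R} \<union> {1/R..R}" using R by (auto intro: less_le_trans[OF R(1)])
    have "\<Phi> t R = \<Phi> t (1/R) + (LINT x:{1/R..R}|lborel. cos (t * x) * \<phi> x)"
      unfolding \<Phi>_def eq
    proof (rule set_integral_Un_AE)
      have "AE x in lborel. x \<noteq> 1/R" by (rule AE_lborel_singleton)
      then show "AE x in lborel. \<not> (x \<in> {0<..1/R} \<and> x \<in> {1/R..R})"
        by eventually_elim auto
    qed (auto intro: integrable_cos_\<phi> sub)
    then show ?case using set_borel_integral_eq_integral(2)[OF sub] by simp
  qed
  ultimately show ?thesis by (simp add: tendsto_cong)
qed

text \<open>The limit controls large cutoffs and the trivial bound \<open>M\<close> the others. This
  uniformity in the cutoff supplies the majorant when the removed ball shrinks.\<close>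

lemma \<Phi>_bounded:
  assumes "t \<noteq> 0"
  shows "\<exists>B. \<forall>M\<ge>0. \<bar>\<Phi> t M\<bar> \<le> B"
proof -
  from tendsto_\<Phi>[OF assms] have "\<forall>\<^sub>F M in at_top. dist (\<Phi> t M) (D 2 \<bar>t\<bar>) < 1"
    by (rule tendstoD) simp
  then obtain M0 where M0: "\<And>M. M \<ge> M0 \<Longrightarrow> \<bar>\<Phi> t M - D 2 \<bar>t\<bar>\<bar> < 1"
    by (auto simp: eventually_at_top_linorder dist_real_def)
  have "\<bar>\<Phi> t M\<bar> \<le> max (\<bar>M0\<bar>) (1 + \<bar>D 2 \<bar>t\<bar>\<bar>)" if "0 \<le> M" for M
    using M0[of M] \<Phi>_bound[OF that, of t] by (cases "M0 \<le> M") linarith+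
  then show ?thesis by blast
qed

end

section \<open>The fractional Laplacian of a one-dimensional profile\<close>

lemma lborel_integral_translate:
  fixes g :: "'a::euclidean_space \<Rightarrow> real"
  assumes "g \<in> borel_measurable borel"
  shows "(LINT y|lborel. g y) = (LINT z|lborel. g (x + z))"
    and "integrable lborel g \<longleftrightarrow> integrable lborel (\<lambda>z. g (x + z))"
proof -
  have "(LINT y|distr lborel borel ((+) x). g y) = (LINT z|lborel. g (x + z))"
    using assms by (subst integral_distr) auto
  then show "(LINT y|lborel. g y) = (LINT z|lborel. g (x + z))"
    by (simp only: lborel_distr_plus)
  have "integrable (distr lborel borel ((+) x)) g \<longleftrightarrow> integrable lborel (\<lambda>z. g (x + z))"
    using assms by (subst integrable_distr_eq) auto
  then show "integrable lborel g \<longleftrightarrow> integrable lborel (\<lambda>z. g (x + z))"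
    by (simp only: lborel_distr_plus)
qed

lemma lborel_integral_scale:
  fixes g :: "'a::euclidean_space \<Rightarrow> real"
  assumes [measurable]: "g \<in> borel_measurable borel" and c: "c \<noteq> 0"
  shows "(LINT y|lborel. g y) = \<bar>c\<bar> ^ DIM('a) * (LINT z|lborel. g (c *\<^sub>R z))"
    and "integrable lborel g \<Longrightarrow> integrable lborel (\<lambda>z. g (c *\<^sub>R z))"
proof -
  note L = lborel_affine[OF c, of "0::'a"]
  have "(LINT y|lborel. g y) = (LINT y|density (distr lborel borel (\<lambda>x::'a. 0 + c *\<^sub>R x)) (\<lambda>_. ennreal (\<bar>c\<bar> ^ DIM('a))). g y)"
    by (subst L) (rule refl)
  also have "\<dots> = (LINT y|distr lborel borel (\<lambda>x::'a. 0 + c *\<^sub>R x). \<bar>c\<bar> ^ DIM('a) *\<^sub>R g y)"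
    by (rule integral_density) auto
  also have "\<dots> = (LINT z|lborel. \<bar>c\<bar> ^ DIM('a) *\<^sub>R g (0 + c *\<^sub>R z))"
    by (rule integral_distr) auto
  finally show "(LINT y|lborel. g y) = \<bar>c\<bar> ^ DIM('a) * (LINT z|lborel. g (c *\<^sub>R z))"
    by simp
  assume "integrable lborel g"
  then have "integrable (density (distr lborel borel (\<lambda>x::'a. 0 + c *\<^sub>R x)) (\<lambda>_. ennreal (\<bar>c\<bar> ^ DIM('a)))) g"
    by (subst (asm) L)
  then have "integrable (distr lborel borel (\<lambda>x::'a. 0 + c *\<^sub>R x)) (\<lambda>y. \<bar>c\<bar> ^ DIM('a) *\<^sub>R g y)"
    by (subst (asm) integrable_density) auto
  then have "integrable lborel (\<lambda>z. \<bar>c\<bar> ^ DIM('a) *\<^sub>R g (0 + c *\<^sub>R z))"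
    by (subst (asm) integrable_distr_eq) auto
  then show "integrable lborel (\<lambda>z. g (c *\<^sub>R z))" using c by simp
qed

text \<open>A measure- and norm-preserving map that carries the arbitrarily chosen coordinate in
  \<open>frac_lap_const\<close> to the coordinate on which a given profile depends.\<close>

definition swap_coords :: "'a \<Rightarrow> 'a \<Rightarrow> 'a::euclidean_space \<Rightarrow> 'a" where
  "swap_coords b c x = (\<Sum>d\<in>Basis. (x \<bullet> Transposition.transpose b c d) *\<^sub>R d)"

context
  fixes b c :: "'a::euclidean_space"
  assumes bc: "b \<in> Basis" "c \<in> Basis"
begin

lemma transpose_Basis: "d \<in> Basis \<Longrightarrow> Transposition.transpose b c d \<in> Basis"
  using bc by (auto simp: Transposition.transpose_def)

lemma bij_transpose_Basis: "bij_betw (Transposition.transpose b c) Basis Basis"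
  by (rule bij_betw_byWitness[where f' = "Transposition.transpose b c"]) (auto simp: transpose_Basis)

lemma swap_coords_inner: "d \<in> Basis \<Longrightarrow> swap_coords b c x \<bullet> d = x \<bullet> Transposition.transpose b c d"
  by (simp add: swap_coords_def inner_sum_left inner_Basis if_distrib cong: if_cong)

lemma norm_swap_coords: "norm (swap_coords b c x) = norm x"
proof -
  have "swap_coords b c x \<bullet> swap_coords b c x = (\<Sum>d\<in>Basis. (x \<bullet> Transposition.transpose b c d) * (x \<bullet> Transposition.transpose b c d))"
    by (subst euclidean_inner) (simp add: swap_coords_inner)
  also have "\<dots> = (\<Sum>d\<in>Basis. (x \<bullet> d) * (x \<bullet> d))"
    using sum.reindex_bij_betw[OF bij_transpose_Basis, of "\<lambda>d. (x \<bullet> d) * (x \<bullet> d)"] .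
  also have "\<dots> = x \<bullet> x" by (rule euclidean_inner[symmetric])
  finally show ?thesis by (simp add: norm_eq_sqrt_inner)
qed

lemma measurable_swap_coords [measurable]: "swap_coords b c \<in> borel_measurable borel"
  unfolding swap_coords_def by measurable

text \<open>Lebesgue measure is determined by boxes, and the preimage of a box is the box with
  permuted corners; its volume is the same product in another order.\<close>

lemma distr_swap_coords: "distr lborel borel (swap_coords b c) = lborel"
proof (rule lborel_eqI[symmetric])
  fix l u :: 'a
  assume lu: "\<And>d. d \<in> Basis \<Longrightarrow> l \<bullet> d \<le> u \<bullet> d"
  have "swap_coords b c -` box l u = box (swap_coords b c l) (swap_coords b c u)"
  proof (intro set_eqI)
    fix x
    have "x \<in> swap_coords b c -` box l u \<longleftrightarrow>
       (\<forall>d\<in>Basis. l \<bullet> d < x \<bullet> Transposition.transpose b c d \<and> x \<bullet> Transposition.transpose b c d < u \<bullet> d)"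
      by (simp add: mem_box swap_coords_inner)
    also have "\<dots> \<longleftrightarrow> (\<forall>d\<in>Basis. l \<bullet> Transposition.transpose b c d < x \<bullet> d \<and> x \<bullet> d < u \<bullet> Transposition.transpose b c d)"
      by (metis transpose_Basis transpose_involutory)
    also have "\<dots> \<longleftrightarrow> x \<in> box (swap_coords b c l) (swap_coords b c u)"
      by (simp add: mem_box swap_coords_inner)
    finally show "x \<in> swap_coords b c -` box l u \<longleftrightarrow> x \<in> box (swap_coords b c l) (swap_coords b c u)" .
  qed
  then have "emeasure (distr lborel borel (swap_coords b c)) (box l u) = emeasure lborel (box (swap_coords b c l) (swap_coords b c u))"
    by (subst emeasure_distr) auto
  also have "\<dots> = ennreal (\<Prod>d\<in>Basis. (swap_coords b c u - swap_coords b c l) \<bullet> d)"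
    by (subst emeasure_lborel_box) (auto simp: swap_coords_inner transpose_Basis lu)
  also have "(\<Prod>d\<in>Basis. (swap_coords b c u - swap_coords b c l) \<bullet> d) = (\<Prod>d\<in>Basis. (u - l) \<bullet> Transposition.transpose b c d)"
    by (intro prod.cong) (auto simp: inner_diff_left swap_coords_inner)
  also have "\<dots> = (\<Prod>d\<in>Basis. (u - l) \<bullet> d)"
    using prod.reindex_bij_betw[OF bij_transpose_Basis, of "\<lambda>d. (u - l) \<bullet> d"] .
  finally show "emeasure (distr lborel borel (swap_coords b c)) (box l u) = ennreal (\<Prod>d\<in>Basis. (u - l) \<bullet> d)" .
qed simp

end

lemma one_minus_cos_le: "1 - cos (y::real) \<le> y\<^sup>2"
proof -
  have "1 - cos y = 2 * (sin (y / 2))\<^sup>2"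
    using cos_double_sin[of "y / 2"] by simp
  also have "(sin (y / 2))\<^sup>2 \<le> (y / 2)\<^sup>2"
    using abs_sin_x_le_abs_x[of "y / 2"] by (simp only: abs_le_square_iff)
  also have "2 * (y / 2)\<^sup>2 \<le> y\<^sup>2" by (simp add: power_divide)
  finally show ?thesis by simp
qed

section \<open>The kernel of the normalising constant\<close>

context frac_order
begin

text \<open>The integrand of the normalising constant. The same function reappears after rescaling
  the second-difference integral, which is why the constant cancels exactly.\<close>

definition kernel :: "'a::euclidean_space \<Rightarrow> 'a \<Rightarrow> real" where
  "kernel b w = (1 - cos (w \<bullet> b)) / norm w powr (real DIM('a) + 2 * s)"

lemma measurable_kernel [measurable]: "kernel b \<in> borel_measurable borel"
  unfolding kernel_def by measurable

lemma kernel_nonneg: "0 \<le> kernel b w"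
  by (simp add: kernel_def)

lemma kernel_le:
  fixes b w :: "'a::euclidean_space"
  assumes "b \<in> Basis" "w \<noteq> 0"
  shows "kernel b w \<le> norm w powr (2 - (real DIM('a) + 2 * s))" "kernel b w \<le> 2 * norm w powr - (real DIM('a) + 2 * s)"
proof -
  have "1 - cos (w \<bullet> b) \<le> (w \<bullet> b)\<^sup>2" by (rule one_minus_cos_le)
  also have "\<dots> \<le> (norm w)\<^sup>2"
    using Basis_le_norm[OF assms(1), of w] by (simp add: abs_le_square_iff[symmetric])
  also have "\<dots> = norm w powr 2" using assms by (simp add: powr_numeral)
  finally have "kernel b w \<le> norm w powr 2 / norm w powr (real DIM('a) + 2 * s)"
    unfolding kernel_def by (intro divide_right_mono) auto
  then show "kernel b w \<le> norm w powr (2 - (real DIM('a) + 2 * s))" by (simp add: powr_diff)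
  have "1 - cos (w \<bullet> b) \<le> 2" using cos_ge_minus_one[of "w \<bullet> b"] by linarith
  then have "kernel b w \<le> 2 / norm w powr (real DIM('a) + 2 * s)"
    unfolding kernel_def by (intro divide_right_mono) auto
  then show "kernel b w \<le> 2 * norm w powr - (real DIM('a) + 2 * s)" by (simp only: powr_minus divide_inverse)
qed

text \<open>Near 0 the quadratic vanishing of \<open>1 - cos\<close> leaves the exponent
  \<open>2 - 2 s + r\<close> above \<open>- DIM('a)\<close>; at infinity \<open>r < 2 s\<close> is
  needed. The case \<open>r = 0\<close> makes the constant finite, and \<open>r = s\<close> serves
  Fubini.\<close>

lemma integrable_kernel_powr:
  fixes b :: "'a::euclidean_space"
  assumes b: "b \<in> Basis" and r: "0 \<le> r" "r < 2 * s"
  shows "integrable lborel (\<lambda>w. kernel b w * norm w powr r)"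
proof (rule integrable_norm_powr_bounds[where C = 2 and \<alpha> = "2 - (real DIM('a) + 2 * s) + r" and \<beta> = "- (real DIM('a) + 2 * s) + r"])
  show "\<bar>kernel b x * norm x powr r\<bar> \<le> 2 * norm x powr (2 - (real DIM('a) + 2 * s) + r)" if "x \<noteq> 0" for x
  proof -
    have "\<bar>kernel b x * norm x powr r\<bar> \<le> norm x powr (2 - (real DIM('a) + 2 * s)) * norm x powr r"
      unfolding abs_mult using kernel_le(1)[OF b that] kernel_nonneg[of b x] by (simp add: mult_right_mono)
    also have "\<dots> = norm x powr (2 - (real DIM('a) + 2 * s) + r)" by (rule powr_add[symmetric])
    finally show ?thesis using powr_ge_zero[of "norm x" "2 - (real DIM('a) + 2 * s) + r"] by linarith
  qed
  show "\<bar>kernel b x * norm x powr r\<bar> \<le> 2 * norm x powr (- (real DIM('a) + 2 * s) + r)" if "1 \<le> norm x" for x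
  proof -
    have x: "x \<noteq> 0" using that by auto
    have "\<bar>kernel b x * norm x powr r\<bar> \<le> 2 * norm x powr - (real DIM('a) + 2 * s) * norm x powr r"
      unfolding abs_mult using kernel_le(2)[OF b x] kernel_nonneg[of b x] by (simp add: mult_right_mono)
    also have "\<dots> = 2 * norm x powr (- (real DIM('a) + 2 * s) + r)" by (simp only: powr_add mult.assoc)
    finally show ?thesis .
  qed
qed (use s r in auto)

lemma integrable_kernel:
  assumes "b \<in> Basis"
  shows "integrable lborel (kernel b)"
proof -
  have "integrable lborel (\<lambda>w. kernel b w * norm w powr 0)"
    using assms s by (intro integrable_kernel_powr) auto
  also have "(\<lambda>w. kernel b w * norm w powr 0) = kernel b"
    by (auto simp: kernel_def fun_eq_iff)
  finally show ?thesis .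
qed

text \<open>On the open unit cube the coordinate lies strictly between 0 and 1, where the cosine is
  below 1. Positivity allows the inverse in the normalising constant to be cancelled.\<close>

lemma integral_kernel_pos:
  fixes b :: "'a::euclidean_space"
  assumes "b \<in> Basis"
  shows "0 < (LINT w|lborel. kernel b w)"
proof -
  have nn: "AE w in lborel. 0 \<le> kernel b w" by (simp add: kernel_nonneg)
  have "(LINT w|lborel. kernel b w) \<noteq> 0"
  proof
    assume "(LINT w|lborel. kernel b w) = 0"
    then have ae: "AE w in lborel. kernel b w = 0"
      using integral_nonneg_eq_0_iff_AE[OF integrable_kernel[OF assms] nn] by simp
    have "AE w in lborel. w \<notin> box 0 (\<Sum>Basis :: 'a)"
      using ae
    proof eventually_elim
      case (elim w)
      show ?case
      proof
        assume "w \<in> box 0 (\<Sum>Basis :: 'a)"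
        then have "0 < w \<bullet> b" "w \<bullet> b < 1" using assms by (auto simp: mem_box)
        then have "cos (w \<bullet> b) < cos 0" using pi_gt3 by (intro cos_monotone_0_pi) auto
        moreover have "w \<noteq> 0" using \<open>0 < w \<bullet> b\<close> by auto
        ultimately show False using elim by (simp add: kernel_def)
      qed
    qed
    moreover have "{w \<in> space lborel. \<not> w \<notin> box 0 (\<Sum>Basis :: 'a)} = box 0 (\<Sum>Basis)" by auto
    ultimately have "emeasure lborel (box 0 (\<Sum>Basis :: 'a)) = 0"
      using AE_iff_measurable[of "box 0 (\<Sum>Basis :: 'a)" lborel "\<lambda>x. x \<notin> box 0 (\<Sum>Basis)"] by simp
    then show False by (subst (asm) emeasure_lborel_box) auto
  qed
  moreover have "0 \<le> (LINT w|lborel. kernel b w)" using nn by (rule integral_nonneg_AE)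
  ultimately show ?thesis by simp
qed

lemma frac_lap_const_eq:
  fixes b :: "'a::euclidean_space"
  assumes b: "b \<in> Basis"
  shows "frac_lap_const TYPE('a) s = inverse (LINT w|lborel. kernel b w)"
proof -
  define c where "c = (SOME b :: 'a. b \<in> Basis)"
  have c: "c \<in> Basis" unfolding c_def using b by (rule someI)
  have "(LINT w|lborel. kernel c w) = (LINT w|distr lborel borel (swap_coords b c). kernel c w)"
    by (simp only: distr_swap_coords[OF b c])
  also have "\<dots> = (LINT w|lborel. kernel c (swap_coords b c w))"
    by (rule integral_distr) (use measurable_swap_coords[OF b c] in auto)
  also have "\<dots> = (LINT w|lborel. kernel b w)"
    unfolding kernel_def norm_swap_coords[OF b c] swap_coords_inner[OF b c c] by simp
  finally show ?thesis
    unfolding frac_lap_const_def kernel_def c_def by simp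
qed

lemma integrable_outside_ball:
  fixes h :: "'a::euclidean_space \<Rightarrow> real"
  assumes [measurable]: "h \<in> borel_measurable borel" and "0 < \<epsilon>"
    and h: "\<And>z. z \<noteq> 0 \<Longrightarrow> \<bar>h z\<bar> \<le> C * norm z powr (s - (real DIM('a) + 2 * s))"
  shows "integrable lborel (\<lambda>z. indicator {z. \<epsilon> \<le> norm z} z * h z)"
proof -
  have meas: "{z::'a. \<epsilon> \<le> norm z} \<in> sets borel" by measurable
  have neg: "s - (real DIM('a) + 2 * s) < 0" using s by simp
  obtain d :: 'a where "d \<in> Basis" using nonempty_Basis by blast
  then have "d \<noteq> 0" "norm d = 1" by (auto simp: nonzero_Basis)
  then have "0 \<le> C" using h[of d] by auto
  \<comment> \<open>The negative power is at most its value at \<epsilon> on the truncated set,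
    which handles the part inside the unit ball; the summand 1 ensures \<open>E \<ge> 1\<close>, so
    that one constant also serves outside.\<close>
  define E where "E = 1 + \<epsilon> powr (s - (real DIM('a) + 2 * s))"
  have E: "1 \<le> E" by (simp add: E_def)
  show ?thesis
  proof (rule integrable_norm_powr_bounds[where C = "C * E" and \<alpha> = 0 and \<beta> = "s - (real DIM('a) + 2 * s)"])
    show "\<bar>indicator {z. \<epsilon> \<le> norm z} x * h x\<bar> \<le> C * E * norm x powr 0" if "x \<noteq> 0" "norm x \<le> 1" for x
    proof (cases "\<epsilon> \<le> norm x")
      case True
      then have "norm x powr (s - (real DIM('a) + 2 * s)) \<le> \<epsilon> powr (s - (real DIM('a) + 2 * s))"
        using \<open>0 < \<epsilon>\<close> neg by (intro powr_mono2') auto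
      then have "norm x powr (s - (real DIM('a) + 2 * s)) \<le> E" by (simp add: E_def)
      then have "C * norm x powr (s - (real DIM('a) + 2 * s)) \<le> C * E"
        using \<open>0 \<le> C\<close> by (rule mult_left_mono)
      then have "\<bar>h x\<bar> \<le> C * E" using h[OF that(1)] by linarith
      then show ?thesis using True that by simp
    qed (use that \<open>0 \<le> C\<close> E in simp)
    show "\<bar>indicator {z. \<epsilon> \<le> norm z} x * h x\<bar> \<le> C * E * norm x powr (s - (real DIM('a) + 2 * s))" if "1 \<le> norm x" for x
    proof -
      have "x \<noteq> 0" using that by auto
      have "\<bar>indicator {z. \<epsilon> \<le> norm z} x * h x\<bar> \<le> \<bar>h x\<bar>" by (simp add: indicator_def)
      also have "\<dots> \<le> C * norm x powr (s - (real DIM('a) + 2 * s))" by (rule h) fact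
      also have "\<dots> \<le> C * E * norm x powr (s - (real DIM('a) + 2 * s))"
        using \<open>0 \<le> C\<close> E by (intro mult_right_mono) (auto simp: mult_le_cancel_left1)
      finally show ?thesis .
    qed
  qed (use s meas in auto)
qed

end

section \<open>The truncated fractional Laplacian of \<open>F\<close> and its limit\<close>

context frac_order
begin

text \<open>The sum \<open>cos (t + y) + cos (t - y)\<close> factorises as
  \<open>2 cos t cos y\<close>; this separates the base point from the increment.\<close>

lemma second_difference_F:
  "2 * F t - F (t + y) - F (t - y) =
     - 2 * (LINT x:{0<..}|lborel. cos (t * x) * (1 - cos (y * x)) * (x powr (- 2 * s) * \<phi> x))"
proof -
  let ?w = "\<lambda>x. x powr (- 2 * s) * \<phi> x"
  have I: "set_integrable lborel {0<..} (\<lambda>x. 2 * ((1 - cos (t * x)) * ?w x))"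
    using integrable_F by (intro set_integrable_mult_right)
  have J: "set_integrable lborel {0<..} (\<lambda>x. 2 * ((1 - cos (t * x)) * ?w x) - (1 - cos ((t + y) * x)) * ?w x)"
    by (rule set_integral_diff(1)[OF I integrable_F])
  have "2 * F t - F (t + y) - F (t - y) =
    (LINT x:{0<..}|lborel. 2 * ((1 - cos (t * x)) * ?w x) - (1 - cos ((t + y) * x)) * ?w x - (1 - cos ((t - y) * x)) * ?w x)"
    unfolding F_def set_integral_diff(2)[OF J integrable_F] set_integral_diff(2)[OF I integrable_F]
      set_integral_mult_right ..
  also have "\<dots> = (LINT x:{0<..}|lborel. - 2 * (cos (t * x) * (1 - cos (y * x)) * ?w x))"
  proof (rule set_lebesgue_integral_cong, simp, intro allI impI)
    fix x :: real
    have c: "cos ((t + y) * x) + cos ((t - y) * x) = 2 * cos (t * x) * cos (y * x)"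
      by (simp add: ring_distribs cos_add cos_diff)
    have "2 * ((1 - cos (t * x)) * ?w x) - (1 - cos ((t + y) * x)) * ?w x - (1 - cos ((t - y) * x)) * ?w x
       = ((cos ((t + y) * x) + cos ((t - y) * x)) - 2 * cos (t * x)) * ?w x"
      by (simp only: ring_distribs)
    also have "\<dots> = - 2 * (cos (t * x) * (1 - cos (y * x)) * ?w x)"
      unfolding c by (simp add: ring_distribs)
    finally show "2 * ((1 - cos (t * x)) * ?w x) - (1 - cos ((t + y) * x)) * ?w x - (1 - cos ((t - y) * x)) * ?w x
       = - 2 * (cos (t * x) * (1 - cos (y * x)) * ?w x)" .
  qed
  finally show ?thesis by (simp only: set_integral_mult_right)
qed

lemma measurable_F [measurable]: "F \<in> borel_measurable borel"
  by (rule borel_measurable_continuous_onI[OF continuous_F])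

lemma F_over_norm_le:
  fixes b z :: "'a::euclidean_space"
  assumes "b \<in> Basis" "z \<noteq> 0" and C: "0 \<le> C" "\<bar>f\<bar> \<le> C * \<bar>z \<bullet> b\<bar> powr s"
  shows "\<bar>f / norm z powr (real DIM('a) + 2 * s)\<bar> \<le> C * norm z powr (s - (real DIM('a) + 2 * s))"
proof -
  have "\<bar>f\<bar> \<le> C * norm z powr s"
    using C(2) mult_left_mono[OF powr_mono2[of s "\<bar>z \<bullet> b\<bar>" "norm z"] C(1)] s Basis_le_norm[OF assms(1), of z]
    by auto
  then have "\<bar>f / norm z powr (real DIM('a) + 2 * s)\<bar> \<le> C * norm z powr s / norm z powr (real DIM('a) + 2 * s)"
    by (simp add: divide_right_mono)
  then show ?thesis by (simp only: powr_diff times_divide_eq_right)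
qed

context
  fixes b :: "'a::euclidean_space"
  assumes b: "b \<in> Basis"
begin

text \<open>Dropping \<open>\<bar>cos (t * x)\<bar> \<le> 1\<close>, the inner frequency integral is
  \<open>F (z \<bullet> b)\<close> itself. Its growth of order \<open>s\<close> is integrable
  against the singular power outside a ball.\<close>

lemma integrable_symmetrised_integrand:
  assumes \<epsilon>: "0 < \<epsilon>"
  shows "integrable (lborel \<Otimes>\<^sub>M lborel) (\<lambda>(z::'a, x). indicator {z. \<epsilon> \<le> norm z} z * indicator {0<..} x *
     (cos (t * x) * (1 - cos ((z \<bullet> b) * x)) * (x powr (- 2 * s) * \<phi> x) / norm z powr (real DIM('a) + 2 * s)))"
    (is "integrable _ (\<lambda>(z, x). ?g z x)")
proof (rule lborel_pair.Fubini_integrable)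
  let ?n = "real DIM('a) + 2 * s"
  let ?w = "\<lambda>x. x powr (- 2 * s) * \<phi> x"
  have [measurable]: "{z::'a. \<epsilon> \<le> norm z} \<in> sets borel" by measurable
  show meas: "(\<lambda>(z, x). ?g z x) \<in> borel_measurable (lborel \<Otimes>\<^sub>M lborel)"
    by measurable
  have int: "integrable lborel (\<lambda>x. indicator {0<..} x * ((1 - cos ((z \<bullet> b) * x)) * ?w x))" for z :: 'a
    using integrable_F[of "z \<bullet> b"] by (simp add: set_integrable_def)
  have le: "norm (?g z x) \<le> indicator {z. \<epsilon> \<le> norm z} z / norm z powr ?n * (indicator {0<..} x * ((1 - cos ((z \<bullet> b) * x)) * ?w x))" for z x
  proof -
    have "\<bar>cos (t * x)\<bar> * ((1 - cos ((z \<bullet> b) * x)) * ?w x / norm z powr ?n) \<le> 1 * ((1 - cos ((z \<bullet> b) * x)) * ?w x / norm z powr ?n)"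
      by (intro mult_right_mono abs_cos_le_one divide_nonneg_nonneg mult_nonneg_nonneg \<phi>_nonneg) auto
    then show ?thesis
      by (cases "\<epsilon> \<le> norm z"; cases "0 < x") (simp_all add: abs_mult \<phi>_nonneg mult.assoc)
  qed
  have int_g: "integrable lborel (?g z)" for z
  proof (rule Bochner_Integration.integrable_bound)
    show "integrable lborel (\<lambda>x. indicator {z. \<epsilon> \<le> norm z} z / norm z powr ?n * (indicator {0<..} x * ((1 - cos ((z \<bullet> b) * x)) * ?w x)))"
      by (intro integrable_mult_right int)
    show "AE x in lborel. norm (?g z x) \<le> norm (indicator {z. \<epsilon> \<le> norm z} z / norm z powr ?n * (indicator {0<..} x * ((1 - cos ((z \<bullet> b) * x)) * ?w x)))"
      by (intro AE_I2 order_trans[OF le]) (simp only: real_norm_def abs_ge_self)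
  qed measurable
  then show "AE z in lborel. integrable lborel (\<lambda>x. (\<lambda>(z, x). ?g z x) (z, x))" by simp
  obtain C where C: "C \<ge> 0" "\<And>t. \<bar>F t\<bar> \<le> C * \<bar>t\<bar> powr s" using F_growth by blast
  have intF: "integrable lborel (\<lambda>z::'a. indicator {z. \<epsilon> \<le> norm z} z * (F (z \<bullet> b) / norm z powr ?n))"
  proof (rule integrable_outside_ball[OF _ \<epsilon>, where C = C])
    show "\<bar>F (z \<bullet> b) / norm z powr ?n\<bar> \<le> C * norm z powr (s - ?n)" if "z \<noteq> 0" for z :: 'a
      by (rule F_over_norm_le[OF b that C])
  qed measurable
  show "integrable lborel (\<lambda>z. LINT x|lborel. norm ((\<lambda>(z, x). ?g z x) (z, x)))"
  proof (rule Bochner_Integration.integrable_bound[OF intF])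
    show "(\<lambda>z. LINT x|lborel. norm ((\<lambda>(z, x). ?g z x) (z, x))) \<in> borel_measurable lborel"
      by measurable
    show "AE z in lborel. norm (LINT x|lborel. norm ((\<lambda>(z, x). ?g z x) (z, x))) \<le> norm (indicator {z. \<epsilon> \<le> norm z} z * (F (z \<bullet> b) / norm z powr ?n))"
    proof (rule AE_I2)
      fix z :: 'a
      have "norm (LINT x|lborel. norm (?g z x)) = (LINT x|lborel. norm (?g z x))"
        by (simp add: integral_nonneg_AE)
      also have "\<dots> \<le> (LINT x|lborel. indicator {z. \<epsilon> \<le> norm z} z / norm z powr ?n * (indicator {0<..} x * ((1 - cos ((z \<bullet> b) * x)) * ?w x)))"
        by (intro integral_mono integrable_norm int_g integrable_mult_right int le)
      also have "\<dots> = indicator {z. \<epsilon> \<le> norm z} z / norm z powr ?n * F (z \<bullet> b)"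
        by (simp only: integral_mult_right_zero F_def set_lebesgue_integral_def real_scaleR_def)
      also have "\<dots> \<le> norm (indicator {z. \<epsilon> \<le> norm z} z * (F (z \<bullet> b) / norm z powr ?n))"
          unfolding real_norm_def by (rule order_trans[OF _ abs_ge_self]) simp
      finally show "norm (LINT x|lborel. norm ((\<lambda>(z, x). ?g z x) (z, x))) \<le> norm (indicator {z. \<epsilon> \<le> norm z} z * (F (z \<bullet> b) / norm z powr ?n))"
        by simp
    qed
  qed
qed

text \<open>Uses \<open>\<phi> x \<le> x powr (s - 1)\<close>, the interpolated bound whose
  primitive grows like \<open>M powr s\<close> and so is matched by a finite kernel moment.\<close>

lemma integral_\<phi>_le:
  assumes "0 \<le> M"
  shows "(LINT x:{0<..M}|lborel. \<phi> x) \<le> M powr s / s"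
proof -
  have hi: "((\<lambda>x. x powr (s - 1)) has_integral M powr (s - 1 + 1) / (s - 1 + 1)) {0..M}"
    using s assms by (intro has_integral_powr_from_0) auto
  have I: "set_integrable lborel {0..M} (\<lambda>x. x powr (s - 1))"
    by (rule set_integrable_lborel_nonneg) (use hi in \<open>auto simp: integrable_on_def\<close>)
  have J: "set_integrable lborel {0<..M} (\<lambda>x. x powr (s - 1))"
    by (rule set_integrable_subset[OF I]) auto
  have K: "set_integrable lborel {0<..M} \<phi>"
    using integrable_cos_\<phi>[of M 0] by simp
  have "(LINT x:{0<..M}|lborel. \<phi> x) \<le> (LINT x:{0<..M}|lborel. x powr (s - 1))"
    using \<phi>_le[of _ "1 - s"] s by (intro set_integral_mono J K) auto
  also have "\<dots> \<le> (LINT x:{0..M}|lborel. x powr (s - 1))"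
    unfolding set_lebesgue_integral_def
    using I J by (intro integral_mono) (auto simp: set_integrable_def indicator_def)
  also have "\<dots> = M powr s / s"
    using set_borel_integral_eq_integral(2)[OF I] integral_unique[OF hi] by simp
  finally show ?thesis .
qed

lemma indicator_outside_scaled_ball: "0 < \<epsilon> \<Longrightarrow> indicator {0<..} x * indicator {w::'a. \<epsilon> * x \<le> norm w} w = (indicator {0<..norm w / \<epsilon>} x :: real)"
  by (auto simp: indicator_def field_simps)

text \<open>The frequency integral up to \<open>norm w / \<epsilon>\<close> costs at most a multiple
  of \<open>norm w powr s\<close>, so absolute integrability reduces to the kernel moment of order
  \<open>s < 2 s\<close>.\<close>

lemma integrable_rescaled_integrand:
  assumes \<epsilon>: "0 < \<epsilon>"
  shows "integrable (lborel \<Otimes>\<^sub>M lborel) (\<lambda>(w::'a, x). indicator {0<..norm w / \<epsilon>} x * (cos (t * x) * \<phi> x * kernel b w))"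
    (is "integrable _ (\<lambda>(w, x). ?h w x)")
proof (rule lborel_pair.Fubini_integrable)
  have "(\<lambda>(w::'a, x). (if 0 < x \<and> x \<le> norm w / \<epsilon> then 1 else 0) * (cos (t * x) * \<phi> x * kernel b w)) \<in> borel_measurable (lborel \<Otimes>\<^sub>M lborel)"
    by measurable
  also have "(\<lambda>(w::'a, x). (if 0 < x \<and> x \<le> norm w / \<epsilon> then 1 else 0) * (cos (t * x) * \<phi> x * kernel b w)) = (\<lambda>(w, x). ?h w x)"
    by (auto simp: fun_eq_iff)
  finally show meas[measurable]: "(\<lambda>(w, x). ?h w x) \<in> borel_measurable (lborel \<Otimes>\<^sub>M lborel)" .
  have int: "integrable lborel (?h w)" for w
    using integrable_mult_left[OF integrable_cos_\<phi>[of "norm w / \<epsilon>" t, unfolded set_integrable_def], of "kernel b w"]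
    by (simp add: mult_ac)
  then show "AE w in lborel. integrable lborel (\<lambda>x. (\<lambda>(w, x). ?h w x) (w, x))" by simp
  have K: "integrable lborel (\<lambda>x. indicator {0<..M} x * \<phi> x)" for M
    using integrable_cos_\<phi>[of M 0] by (simp add: set_integrable_def)
  show "integrable lborel (\<lambda>w. LINT x|lborel. norm ((\<lambda>(w, x). ?h w x) (w, x)))"
  proof (rule Bochner_Integration.integrable_bound)
    show "integrable lborel (\<lambda>w. 1 / (\<epsilon> powr s * s) * (kernel b w * norm w powr s))"
      using s by (intro integrable_mult_right integrable_kernel_powr b) auto
    show "(\<lambda>w. LINT x|lborel. norm ((\<lambda>(w, x). ?h w x) (w, x))) \<in> borel_measurable lborel"
      by measurable
    show "AE w in lborel. norm (LINT x|lborel. norm ((\<lambda>(w, x). ?h w x) (w, x))) \<le> norm (1 / (\<epsilon> powr s * s) * (kernel b w * norm w powr s))"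
    proof (rule AE_I2)
      fix w :: 'a
      have "norm (LINT x|lborel. norm (?h w x)) = (LINT x|lborel. norm (?h w x))"
        by (simp add: integral_nonneg_AE)
      also have "\<dots> \<le> (LINT x|lborel. kernel b w * (indicator {0<..norm w / \<epsilon>} x * \<phi> x))"
      proof (intro integral_mono integrable_norm int integrable_mult_right K)
        show "norm (?h w x) \<le> kernel b w * (indicator {0<..norm w / \<epsilon>} x * \<phi> x)" for x
        proof -
          have "\<bar>cos (t * x)\<bar> * (\<phi> x * kernel b w) \<le> 1 * (\<phi> x * kernel b w)"
            by (intro mult_right_mono abs_cos_le_one mult_nonneg_nonneg \<phi>_nonneg kernel_nonneg)
          then show ?thesis
            by (cases "x \<in> {0<..norm w / \<epsilon>}") (simp_all add: abs_mult \<phi>_nonneg kernel_nonneg mult_ac)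
        qed
      qed
      also have "\<dots> = kernel b w * (LINT x:{0<..norm w / \<epsilon>}|lborel. \<phi> x)"
        by (simp only: integral_mult_right_zero set_lebesgue_integral_def real_scaleR_def)
      also have "\<dots> \<le> kernel b w * ((norm w / \<epsilon>) powr s / s)"
        using \<epsilon> by (intro mult_left_mono kernel_nonneg integral_\<phi>_le) auto
      also have "\<dots> = 1 / (\<epsilon> powr s * s) * (kernel b w * norm w powr s)"
        using \<epsilon> by (simp add: powr_divide)
      also have "\<dots> \<le> norm (1 / (\<epsilon> powr s * s) * (kernel b w * norm w powr s))"
        unfolding real_norm_def by (rule abs_ge_self)
      finally show "norm (LINT x|lborel. norm ((\<lambda>(w, x). ?h w x) (w, x))) \<le> norm (1 / (\<epsilon> powr s * s) * (kernel b w * norm w powr s))"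
        by simp
    qed
  qed measurable
qed

text \<open>Substitution \<open>w = x z\<close> for fixed frequency \<open>x > 0\<close>: the
  Jacobian \<open>x^N\<close> (with \<open>N\<close> the dimension) against the homogeneity
  \<open>x^(N + 2 s)\<close> leaves exactly \<open>x^(- 2 s)\<close>, so the singular weight is
  absorbed and only \<open>\<phi>\<close> remains. For \<open>x \<le> 0\<close> both indicators
  vanish.\<close>

lemma integral_rescaled_integrand:
  assumes \<epsilon>: "0 < \<epsilon>"
  shows "(LINT z|lborel. indicator {z. \<epsilon> \<le> norm z} z * indicator {0<..} x *
     (cos (t * x) * (1 - cos ((z \<bullet> b) * x)) * (x powr (- 2 * s) * \<phi> x) / norm z powr (real DIM('a) + 2 * s)))
    = (LINT w|lborel. indicator {0<..norm (w::'a) / \<epsilon>} x * (cos (t * x) * \<phi> x * kernel b w))"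
proof (cases "0 < x")
  case True
  let ?n = "real DIM('a) + 2 * s"
  let ?H = "\<lambda>w::'a. indicator {w. \<epsilon> * x \<le> norm w} w * (cos (t * x) * \<phi> x * kernel b w)"
  have [measurable]: "{w::'a. \<epsilon> * x \<le> norm w} \<in> sets borel" by measurable
  have "(LINT w|lborel. indicator {0<..norm w / \<epsilon>} x * (cos (t * x) * \<phi> x * kernel b w)) = (LINT w|lborel. ?H w)"
    using True by (simp add: indicator_outside_scaled_ball[OF \<epsilon>, symmetric])
  also have "\<dots> = \<bar>x\<bar> ^ DIM('a) * (LINT z|lborel. ?H (x *\<^sub>R z))"
    by (rule lborel_integral_scale(1)) (use True in auto)
  also have "\<dots> = (LINT z|lborel. \<bar>x\<bar> ^ DIM('a) * ?H (x *\<^sub>R z))"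
    by (rule integral_mult_right_zero[symmetric])
  also have "\<dots> = (LINT z|lborel. indicator {z. \<epsilon> \<le> norm z} z * indicator {0<..} x *
     (cos (t * x) * (1 - cos ((z \<bullet> b) * x)) * (x powr (- 2 * s) * \<phi> x) / norm z powr ?n))"
  proof (rule Bochner_Integration.integral_cong[OF refl])
    fix z :: 'a
    have i: "indicator {w. \<epsilon> * x \<le> norm w} (x *\<^sub>R z) = (indicator {z. \<epsilon> \<le> norm z} z :: real)"
      using True by (auto simp: indicator_def mult.commute)
    have "x ^ DIM('a) / x powr ?n = x powr (- 2 * s)"
      using True by (simp add: powr_realpow[symmetric] powr_diff[symmetric])
    moreover have "kernel b (x *\<^sub>R z) = (1 - cos ((z \<bullet> b) * x)) / (x powr ?n * norm z powr ?n)"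
      using True by (simp add: kernel_def powr_mult mult.commute)
    then have "x ^ DIM('a) * kernel b (x *\<^sub>R z) = (1 - cos ((z \<bullet> b) * x)) * (x ^ DIM('a) / x powr ?n) / norm z powr ?n"
      by simp
    ultimately have k: "x ^ DIM('a) * kernel b (x *\<^sub>R z) = (1 - cos ((z \<bullet> b) * x)) * x powr (- 2 * s) / norm z powr ?n"
      by (simp only:)
    have "\<bar>x\<bar> ^ DIM('a) * ?H (x *\<^sub>R z) = indicator {z. \<epsilon> \<le> norm z} z * (cos (t * x) * \<phi> x * (x ^ DIM('a) * kernel b (x *\<^sub>R z)))"
      unfolding i using True by simp
    then show "\<bar>x\<bar> ^ DIM('a) * ?H (x *\<^sub>R z) = indicator {z. \<epsilon> \<le> norm z} z * indicator {0<..} x *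
     (cos (t * x) * (1 - cos ((z \<bullet> b) * x)) * (x powr (- 2 * s) * \<phi> x) / norm z powr ?n)"
      unfolding k using True by simp
  qed
  finally show ?thesis ..
qed simp

text \<open>Symmetrising \<open>z \<mapsto> - z\<close> replaces the first difference of \<open>F\<close> by a second difference, whose
  cosine integral factorises. After Fubini, the substitution \<open>w = x z\<close> turns the truncation
  \<open>norm z \<ge> \<epsilon>\<close> into \<open>x \<le> norm w / \<epsilon>\<close>, and a second use of Fubini leaves the truncated
  cosine integral \<open>\<Phi>\<close>, which is bounded and converges as \<open>\<epsilon>\<close> tends to \<open>0\<close>.\<close>

lemma truncated_frac_lap_F:
  fixes x :: 'a and q :: real
  assumes \<epsilon>: "0 < \<epsilon>"
  shows "set_integrable lborel (- ball x \<epsilon>) (frac_lap_integrand s (\<lambda>y. F (y \<bullet> b - q)) x)"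
    and "(LINT y:(- ball x \<epsilon>)|lborel. frac_lap_integrand s (\<lambda>y. F (y \<bullet> b - q)) x y)
      = - (LINT w|lborel. kernel b w * \<Phi> (x \<bullet> b - q) (norm w / \<epsilon>))"
proof -
  let ?n = "real DIM('a) + 2 * s"
  define t where "t = x \<bullet> b - q"
  define J where "J z = indicator {z. \<epsilon> \<le> norm z} z * ((F t - F (t + z \<bullet> b)) / norm z powr ?n)" for z :: 'a
  define g where "g z y = indicator {z. \<epsilon> \<le> norm z} z * indicator {0<..} y *
     (cos (t * y) * (1 - cos ((z \<bullet> b) * y)) * (y powr (- 2 * s) * \<phi> y) / norm z powr ?n)" for z :: 'a and y
  define h where "h w y = indicator {0<..norm w / \<epsilon>} y * (cos (t * y) * \<phi> y * kernel b w)" for w :: 'a and y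
  have [measurable]: "{z::'a. \<epsilon> \<le> norm z} \<in> sets borel" by measurable
  have [measurable]: "J \<in> borel_measurable borel" unfolding J_def by measurable
  obtain C where C: "\<And>t u. \<bar>F t - F u\<bar> \<le> C * \<bar>t - u\<bar> powr s" using F_holder by blast
  have "0 \<le> C" using C[of 1 0] by auto
  have J: "integrable lborel J"
    unfolding J_def
  proof (rule integrable_outside_ball[OF _ \<epsilon>, where C = C])
    show "\<bar>(F t - F (t + z \<bullet> b)) / norm z powr ?n\<bar> \<le> C * norm z powr (s - ?n)" if "z \<noteq> 0" for z :: 'a
      by (rule F_over_norm_le[OF b that \<open>0 \<le> C\<close>]) (use C[of t "t + z \<bullet> b"] in simp)
  qed measurable
  let ?f = "\<lambda>y. indicator (- ball x \<epsilon>) y *\<^sub>R frac_lap_integrand s (\<lambda>y. F (y \<bullet> b - q)) x y"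
  have f_meas: "?f \<in> borel_measurable borel"
    unfolding frac_lap_integrand_def by measurable
  have f_J: "?f (x + z) = J z" for z
    unfolding J_def frac_lap_integrand_def t_def
    by (auto simp: indicator_def dist_norm inner_add_left algebra_simps)
  show "set_integrable lborel (- ball x \<epsilon>) (frac_lap_integrand s (\<lambda>y. F (y \<bullet> b - q)) x)"
    unfolding set_integrable_def lborel_integral_translate(2)[OF f_meas, of x] f_J by (rule J)
  have "(LINT y:(- ball x \<epsilon>)|lborel. frac_lap_integrand s (\<lambda>y. F (y \<bullet> b - q)) x y) = (LINT z|lborel. J z)"
    unfolding set_lebesgue_integral_def lborel_integral_translate(1)[OF f_meas, of x] f_J ..
  moreover have "(LINT z|lborel. J z) = (LINT z|lborel. J (- z))"
    using lborel_integral_scale(1)[of J "-1"] by simp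
  moreover have "integrable lborel (\<lambda>z. J (- z))"
    using lborel_integral_scale(2)[of J "-1"] J by simp
  then have "(LINT z|lborel. J z) + (LINT z|lborel. J (- z)) = (LINT z|lborel. J z + J (- z))"
    by (rule Bochner_Integration.integral_add[OF J, symmetric])
  moreover have "J z + J (- z) = - 2 * (LINT y|lborel. g z y)" for z
  proof -
    have "J z + J (- z) = indicator {z. \<epsilon> \<le> norm z} z / norm z powr ?n * (2 * F t - F (t + z \<bullet> b) - F (t - z \<bullet> b))"
      by (simp add: J_def indicator_def add_divide_distrib[symmetric])
    also have "\<dots> = - 2 * (indicator {z. \<epsilon> \<le> norm z} z / norm z powr ?n *
        (LINT y:{0<..}|lborel. cos (t * y) * (1 - cos (z \<bullet> b * y)) * (y powr (- 2 * s) * \<phi> y)))"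
      unfolding second_difference_F by simp
    also have "\<dots> = - 2 * (LINT y|lborel. g z y)"
      unfolding g_def set_lebesgue_integral_def integral_mult_right_zero[symmetric]
      by (rule Bochner_Integration.integral_cong[OF refl]) (simp add: mult_ac)
    finally show ?thesis .
  qed
  moreover have "(LINT z|lborel. - 2 * (LINT y|lborel. g z y)) = - 2 * (LINT y|lborel. LINT z|lborel. g z y)"
  proof -
    have "(LINT y|lborel. LINT z|lborel. g z y) = (LINT z|lborel. LINT y|lborel. g z y)"
      by (rule lborel_pair.Fubini_integral) (use integrable_symmetrised_integrand[OF \<epsilon>, of t] in \<open>simp add: g_def\<close>)
    then show ?thesis by (simp only: integral_mult_right_zero)
  qed
  moreover have "(LINT z|lborel. g z y) = (LINT w|lborel. h w y)" for y
    unfolding g_def h_def by (rule integral_rescaled_integrand[OF \<epsilon>])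
  moreover have "(LINT y|lborel. LINT w|lborel. h w y) = (LINT w|lborel. LINT y|lborel. h w y)"
    by (rule lborel_pair.Fubini_integral) (use integrable_rescaled_integrand[OF \<epsilon>, of t] in \<open>simp add: h_def\<close>)
  moreover have "(LINT y|lborel. h w y) = kernel b w * \<Phi> t (norm w / \<epsilon>)" for w
    unfolding h_def \<Phi>_def set_lebesgue_integral_def integral_mult_right_zero[symmetric]
    by (intro Bochner_Integration.integral_cong refl) (simp add: mult_ac)
  ultimately show "(LINT y:(- ball x \<epsilon>)|lborel. frac_lap_integrand s (\<lambda>y. F (y \<bullet> b - q)) x y)
      = - (LINT w|lborel. kernel b w * \<Phi> (x \<bullet> b - q) (norm w / \<epsilon>))"
    unfolding t_def[symmetric] by simp
qed

lemma measurable_\<Phi> [measurable]: "\<Phi> t \<in> borel_measurable borel"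
proof -
  have "\<Phi> t = (\<lambda>M. LINT x|lborel. (if 0 < x \<and> x \<le> M then cos (t * x) * \<phi> x else 0))"
    unfolding \<Phi>_def set_lebesgue_integral_def
    by (intro ext Bochner_Integration.integral_cong refl) (simp add: indicator_def)
  also have "\<dots> \<in> borel_measurable borel" by measurable
  finally show ?thesis .
qed

text \<open>For each \<open>w \<noteq> 0\<close> the cutoff \<open>norm w / \<epsilon>\<close> tends
  to infinity, so \<open>\<Phi>\<close> tends to \<open>D 2\<close>. A constant multiple of the
  integrable kernel dominates, and the integral of the kernel is cancelled by the normalising
  constant.\<close>

lemma has_frac_lap_F:
  fixes x :: 'a and q :: real
  assumes t: "x \<bullet> b \<noteq> q"
  shows "has_frac_lap s (\<lambda>y. F (y \<bullet> b - q)) x (- D 2 \<bar>x \<bullet> b - q\<bar>)"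
  unfolding has_frac_lap_def
proof (intro conjI allI impI truncated_frac_lap_F(1))
  define K where "K = (LINT w|lborel. kernel b (w::'a))"
  have K: "0 < K" unfolding K_def by (rule integral_kernel_pos[OF b])
  define t where "t = x \<bullet> b - q"
  have t: "t \<noteq> 0" using t by (simp add: t_def)
  obtain B where B: "\<And>M. 0 \<le> M \<Longrightarrow> \<bar>\<Phi> t M\<bar> \<le> B" using \<Phi>_bounded[OF t] by blast
  \<comment> \<open>\<open>T\<close> stands for \<open>1 / \<epsilon>\<close>, so that dominated
    convergence can be applied at infinity.\<close>
  have "((\<lambda>T. LINT w|lborel. kernel b (w::'a) * \<Phi> t (norm w * T)) \<longlongrightarrow> (LINT w|lborel. kernel b (w::'a) * D 2 \<bar>t\<bar>)) at_top"
  proof (rule integral_dominated_convergence_at_top[where w = "\<lambda>w. kernel b w * B"])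
    show "integrable lborel (\<lambda>w::'a. kernel b w * B)"
      by (intro integrable_mult_left integrable_kernel b)
    show "\<forall>\<^sub>F T in at_top. AE w::'a in lborel. norm (kernel b w * \<Phi> t (norm w * T)) \<le> kernel b w * B"
      using eventually_ge_at_top[of 0]
    proof eventually_elim
      case (elim T)
      then show ?case
        by (intro AE_I2) (simp add: abs_mult kernel_nonneg mult_left_mono B)
    qed
    show "AE w::'a in lborel. ((\<lambda>T. kernel b w * \<Phi> t (norm w * T)) \<longlongrightarrow> kernel b w * D 2 \<bar>t\<bar>) at_top"
    proof (rule AE_I2)
      fix w :: 'a
      show "((\<lambda>T. kernel b w * \<Phi> t (norm w * T)) \<longlongrightarrow> kernel b w * D 2 \<bar>t\<bar>) at_top"
      proof (cases "w = 0")
        case False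
        then have "filterlim (\<lambda>T. norm w * T) at_top at_top"
          by (intro filterlim_tendsto_pos_mult_at_top[OF tendsto_const _ filterlim_ident]) simp
        then show ?thesis
          by (intro tendsto_mult tendsto_const filterlim_compose[OF tendsto_\<Phi>[OF t]])
      qed (simp add: kernel_def)
    qed
  qed measurable
  also have "(LINT w|lborel. kernel b (w::'a) * D 2 \<bar>t\<bar>) = K * D 2 \<bar>t\<bar>"
    unfolding K_def by simp
  finally have "((\<lambda>T. inverse K * - (LINT w|lborel. kernel b (w::'a) * \<Phi> t (norm w * T))) \<longlongrightarrow> inverse K * - (K * D 2 \<bar>t\<bar>)) at_top"
    by (intro tendsto_intros)
  also have "inverse K * - (K * D 2 \<bar>t\<bar>) = - D 2 \<bar>t\<bar>"
    using K by (simp add: field_simps)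
  finally have "((\<lambda>T. inverse K * - (LINT w|lborel. kernel b (w::'a) * \<Phi> t (norm w * T))) \<longlongrightarrow> - D 2 \<bar>t\<bar>) at_top" .
  then have "((\<lambda>\<epsilon>. inverse K * - (LINT w|lborel. kernel b (w::'a) * \<Phi> t (norm w / \<epsilon>))) \<longlongrightarrow> - D 2 \<bar>t\<bar>) (at_right 0)"
    unfolding filterlim_at_right_to_top by (simp add: divide_inverse)
  moreover have "\<forall>\<^sub>F \<epsilon> in at_right 0. inverse K * - (LINT w|lborel. kernel b (w::'a) * \<Phi> t (norm w / \<epsilon>)) =
      frac_lap_const TYPE('a) s * (LINT y:(- ball x \<epsilon>)|lborel. frac_lap_integrand s (\<lambda>y. F (y \<bullet> b - q)) x y)"
    using eventually_at_right_less
  proof eventually_elim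
    case (elim \<epsilon>)
    show ?case
      unfolding truncated_frac_lap_F(2)[OF elim] frac_lap_const_eq[OF b] K_def t_def ..
  qed
  ultimately show "((\<lambda>\<epsilon>. frac_lap_const TYPE('a) s * (LINT y:(- ball x \<epsilon>)|lborel. frac_lap_integrand s (\<lambda>y. F (y \<bullet> b - q)) x y))
      \<longlongrightarrow> - D 2 \<bar>x \<bullet> b - q\<bar>) (at_right 0)"
    unfolding t_def[symmetric] by (rule Lim_transform_eventually)
qed

end

end

section \<open>Sums of one-dimensional profiles\<close>

lemma has_frac_lap_const: "has_frac_lap s (\<lambda>_. k) x 0"
  by (simp add: has_frac_lap_def frac_lap_integrand_def set_integrable_def)

lemma has_frac_lap_uminus:
  fixes u :: "'a::euclidean_space \<Rightarrow> real"
  assumes "has_frac_lap s u x l"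
  shows "has_frac_lap s (\<lambda>y. - u y) x (- l)"
proof -
  have eq: "frac_lap_integrand s (\<lambda>y. - u y) x = (\<lambda>y. (-1) * frac_lap_integrand s u x y)"
    by (auto simp: frac_lap_integrand_def fun_eq_iff minus_divide_left)
  show ?thesis
    unfolding has_frac_lap_def eq set_integral_mult_right
  proof (intro conjI allI impI set_integrable_mult_right)
    show "set_integrable lborel (- ball x \<epsilon>) (frac_lap_integrand s u x)" if "0 < \<epsilon>" for \<epsilon>
      using assms that unfolding has_frac_lap_def by blast
    have "((\<lambda>\<epsilon>. frac_lap_const TYPE('a) s * (LINT y:(- ball x \<epsilon>)|lborel. frac_lap_integrand s u x y)) \<longlongrightarrow> l) (at_right 0)"
      using assms unfolding has_frac_lap_def by blast
    from tendsto_minus[OF this]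
    show "((\<lambda>\<epsilon>. frac_lap_const TYPE('a) s * (- 1 * (LINT y:(- ball x \<epsilon>)|lborel. frac_lap_integrand s u x y))) \<longlongrightarrow> - l) (at_right 0)"
      by simp
  qed
qed

lemma has_frac_lap_add:
  fixes u w :: "'a::euclidean_space \<Rightarrow> real"
  assumes u: "has_frac_lap s u x l" and w: "has_frac_lap s w x m"
  shows "has_frac_lap s (\<lambda>y. u y + w y) x (l + m)"
  unfolding has_frac_lap_def
proof (intro conjI allI impI)
  have eq: "frac_lap_integrand s (\<lambda>y. u y + w y) x = (\<lambda>y. frac_lap_integrand s u x y + frac_lap_integrand s w x y)"
    by (auto simp: frac_lap_integrand_def fun_eq_iff add_divide_distrib[symmetric])
  have int: "set_integrable lborel (- ball x \<epsilon>) (frac_lap_integrand s u x)"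
    "set_integrable lborel (- ball x \<epsilon>) (frac_lap_integrand s w x)" if "0 < \<epsilon>" for \<epsilon>
    using u w that unfolding has_frac_lap_def by blast+
  then show "set_integrable lborel (- ball x \<epsilon>) (frac_lap_integrand s (\<lambda>y. u y + w y) x)" if "0 < \<epsilon>" for \<epsilon>
    unfolding eq using that by (intro set_integral_add(1))
  let ?I = "\<lambda>u \<epsilon>. frac_lap_const TYPE('a) s * (LINT y:(- ball x \<epsilon>)|lborel. frac_lap_integrand s u x y)"
  have "((\<lambda>\<epsilon>. ?I u \<epsilon> + ?I w \<epsilon>) \<longlongrightarrow> l + m) (at_right 0)"
    using u w unfolding has_frac_lap_def by (intro tendsto_add) blast+
  moreover have "\<forall>\<^sub>F \<epsilon> in at_right 0. ?I u \<epsilon> + ?I w \<epsilon> = ?I (\<lambda>y. u y + w y) \<epsilon>"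
    using eventually_at_right_less
    by eventually_elim (simp only: eq set_integral_add(2)[OF int] distrib_left)
  ultimately show "(?I (\<lambda>y. u y + w y) \<longlongrightarrow> l + m) (at_right 0)"
    by (rule Lim_transform_eventually)
qed

lemma has_frac_lap_sum:
  assumes "finite A" "\<And>i. i \<in> A \<Longrightarrow> has_frac_lap s (u i) x (l i)"
  shows "has_frac_lap s (\<lambda>y. \<Sum>i\<in>A. u i y) x (\<Sum>i\<in>A. l i)"
  using assms
proof (induction A rule: finite_induct)
  case empty
  then show ?case by (simp add: has_frac_lap_const)
next
  case (insert i A)
  then have "has_frac_lap s (\<lambda>y. u i y + (\<Sum>i\<in>A. u i y)) x (l i + (\<Sum>i\<in>A. l i))"
    by (intro has_frac_lap_add) auto
  then show ?case using insert by simp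
qed

text \<open>The one-dimensional hypotheses are asked only at coordinates of points of
  \<open>S\<close>, since the profile used later is smooth only between its two singular
  points.\<close>

locale separable =
  fixes S :: "'a::euclidean_space set" and V V' V'' :: "real \<Rightarrow> real" and k :: real
  assumes open_S: "open S"
    and V': "\<And>x b. x \<in> S \<Longrightarrow> b \<in> Basis \<Longrightarrow> (V has_real_derivative V' (x \<bullet> b)) (at (x \<bullet> b))"
    and V'': "\<And>x b. x \<in> S \<Longrightarrow> b \<in> Basis \<Longrightarrow> (V' has_real_derivative V'' (x \<bullet> b)) (at (x \<bullet> b))"
    and cont_V'': "\<And>x b. x \<in> S \<Longrightarrow> b \<in> Basis \<Longrightarrow> isCont V'' (x \<bullet> b)"
begin

definition v :: "'a \<Rightarrow> real" where "v x = (\<Sum>b\<in>Basis. V (x \<bullet> b)) + k"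

lemma has_derivative_along:
  assumes f: "(f has_real_derivative D) (at (x \<bullet> b))"
  shows "((\<lambda>t. f ((x + t *\<^sub>R c) \<bullet> b)) has_real_derivative D * (c \<bullet> b)) (at 0)"
proof -
  have "((\<lambda>t. (x + t *\<^sub>R c) \<bullet> b) has_real_derivative c \<bullet> b) (at 0)"
    by (auto intro!: derivative_eq_intros simp: inner_add_left)
  moreover have "(f has_real_derivative D) (at ((x + 0 *\<^sub>R c) \<bullet> b))" using f by simp
  ultimately show ?thesis by (rule DERIV_chain2[rotated])
qed

lemma derivative_v:
  assumes "x \<in> S" "c \<in> Basis"
  shows "((\<lambda>t. v (x + t *\<^sub>R c)) has_real_derivative V' (x \<bullet> c)) (at 0)"
proof -
  have "((\<lambda>t. v (x + t *\<^sub>R c)) has_real_derivative (\<Sum>b\<in>Basis. V' (x \<bullet> b) * (c \<bullet> b)) + 0) (at 0)"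
    unfolding v_def using V' assms by (intro DERIV_add DERIV_sum DERIV_const has_derivative_along) auto
  also have "(\<Sum>b\<in>Basis. V' (x \<bullet> b) * (c \<bullet> b)) + 0 = V' (x \<bullet> c)"
    using assms by (simp add: inner_Basis if_distrib cong: if_cong)
  finally show ?thesis .
qed

lemma pderiv_v: "x \<in> S \<Longrightarrow> c \<in> Basis \<Longrightarrow> pderiv_dir c v x = V' (x \<bullet> c)"
  unfolding pderiv_dir_def by (rule DERIV_imp_deriv[OF derivative_v])

lemma derivative_pderiv_v:
  assumes x: "x \<in> S" and c: "c \<in> Basis" and b: "b \<in> Basis"
  shows "((\<lambda>t. pderiv_dir c v (x + t *\<^sub>R b)) has_real_derivative (if b = c then V'' (x \<bullet> c) else 0)) (at 0)"
proof -
  have "((\<lambda>t. V' ((x + t *\<^sub>R b) \<bullet> c)) has_real_derivative V'' (x \<bullet> c) * (b \<bullet> c)) (at 0)"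
    using V'' x c by (intro has_derivative_along) auto
  also have "V'' (x \<bullet> c) * (b \<bullet> c) = (if b = c then V'' (x \<bullet> c) else 0)"
    using b c by (simp add: inner_Basis)
  finally have *: "((\<lambda>t. V' ((x + t *\<^sub>R b) \<bullet> c)) has_real_derivative (if b = c then V'' (x \<bullet> c) else 0)) (at 0)" .
  \<comment> \<open>The formula for the first partial derivative holds only on \<open>S\<close>;
    openness makes it valid for all small \<open>t\<close>, which is enough to differentiate
    it.\<close>
  have "open ((\<lambda>t::real. x + t *\<^sub>R b) -` S)"
    by (intro open_vimage open_S continuous_intros)
  from has_field_derivative_transform_within_open[OF * this] show ?thesis
    using x c by (simp add: pderiv_v)
qed

lemma pderiv_pderiv_v:
  "x \<in> S \<Longrightarrow> c \<in> Basis \<Longrightarrow> b \<in> Basis \<Longrightarrow> pderiv_dir b (pderiv_dir c v) x = (if b = c then V'' (x \<bullet> c) else 0)"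
  unfolding pderiv_dir_def[of b] by (rule DERIV_imp_deriv[OF derivative_pderiv_v])

lemma continuous_on_coordinate:
  assumes "\<And>x. x \<in> S \<Longrightarrow> isCont f (x \<bullet> c)"
  shows "continuous_on S (\<lambda>x. f (x \<bullet> c))"
proof (intro continuous_at_imp_continuous_on ballI)
  fix x assume "x \<in> S"
  have "isCont (\<lambda>x. x \<bullet> c) x" by (intro continuous_intros)
  then show "isCont (\<lambda>x. f (x \<bullet> c)) x" by (rule isCont_o2) (rule assms, fact)
qed

lemma continuous_on_pderiv: "c \<in> Basis \<Longrightarrow> continuous_on S (pderiv_dir c v)"
proof -
  assume c: "c \<in> Basis"
  have "continuous_on S (\<lambda>x. V' (x \<bullet> c))"
    using V'' c by (intro continuous_on_coordinate) (auto intro: DERIV_isCont)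
  then show ?thesis
    by (rule continuous_on_eq) (simp add: pderiv_v c)
qed

lemma C2_on_v: "C2_on S v"
  unfolding C2_on_def C1_on_def
proof (intro conjI ballI)
  have "continuous_on S (\<lambda>x. V (x \<bullet> b))" if "b \<in> Basis" for b
    using V' that by (intro continuous_on_coordinate) (auto intro: DERIV_isCont)
  then show "continuous_on S v"
    unfolding v_def by (intro continuous_intros) auto
  fix c :: 'a assume c: "c \<in> Basis"
  show "continuous_on S (pderiv_dir c v)" "continuous_on S (pderiv_dir c v)"
    using c by (rule continuous_on_pderiv)+
  show "(\<lambda>t. v (x + t *\<^sub>R c)) field_differentiable at 0" if "x \<in> S" for x
    using derivative_v[OF that c] unfolding field_differentiable_def by blast
  fix b :: 'a assume b: "b \<in> Basis"
  show "(\<lambda>t. pderiv_dir c v (x + t *\<^sub>R b)) field_differentiable at 0" if "x \<in> S" for x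
    using derivative_pderiv_v[OF that c b] unfolding field_differentiable_def by blast
  have "continuous_on S (\<lambda>x. if b = c then V'' (x \<bullet> c) else 0)"
    using cont_V'' c by (cases "b = c") (auto intro: continuous_on_coordinate)
  then show "continuous_on S (pderiv_dir b (pderiv_dir c v))"
    by (rule continuous_on_eq) (simp add: pderiv_pderiv_v b c)
qed

lemma laplacian_v: "x \<in> S \<Longrightarrow> laplacian v x = (\<Sum>b\<in>Basis. V'' (x \<bullet> b))"
  unfolding laplacian_def by (intro sum.cong) (auto simp: pderiv_pderiv_v)

end

section \<open>The even profile \<open>W\<close> and the final function\<close>

context frac_order
begin

definition W :: "real \<Rightarrow> real \<Rightarrow> real" where
  "W p y = 2 * F p - F (p - y) - F (p + y)"

lemma W_derivatives:
  assumes "\<bar>y\<bar> < p"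
  shows "(W p has_real_derivative D 1 (p - y) - D 1 (p + y)) (at y)"
    and "((\<lambda>y. D 1 (p - y) - D 1 (p + y)) has_real_derivative D 2 (p - y) + D 2 (p + y)) (at y)"
    and "isCont (\<lambda>y. D 2 (p - y) + D 2 (p + y)) y"
proof -
  have p: "0 < p - y" "0 < p + y" using assms by auto
  have m: "((\<lambda>y. p - y) has_real_derivative - 1) (at y)" "((\<lambda>y. p + y) has_real_derivative 1) (at y)"
    by (auto intro!: derivative_eq_intros)
  note D1 = D_derivative[of _ 0, unfolded One_nat_def[symmetric] Suc_1]
  have "((\<lambda>y. 2 * F p - F (p - y) - F (p + y)) has_real_derivative 0 - D 1 (p - y) * - 1 - D 1 (p + y) * 1) (at y)"
    by (intro DERIV_diff DERIV_const DERIV_chain2[OF F_derivative[OF p(1)] m(1)] DERIV_chain2[OF F_derivative[OF p(2)] m(2)])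
  then show "(W p has_real_derivative D 1 (p - y) - D 1 (p + y)) (at y)"
    unfolding W_def by simp
  have "((\<lambda>y. D 1 (p - y) - D 1 (p + y)) has_real_derivative - D 2 (p - y) * - 1 - (- D 2 (p + y)) * 1) (at y)"
    by (intro DERIV_diff DERIV_chain2[OF D1[OF p(1)] m(1)] DERIV_chain2[OF D1[OF p(2)] m(2)])
  then show "((\<lambda>y. D 1 (p - y) - D 1 (p + y)) has_real_derivative D 2 (p - y) + D 2 (p + y)) (at y)"
    by simp
  have D2: "isCont (D 2) t" if "0 < t" for t
    using D_derivative[OF that, of 1, unfolded Suc_1] by (rule DERIV_isCont)
  then show "isCont (\<lambda>y. D 2 (p - y) + D 2 (p + y)) y"
    by (intro continuous_add isCont_o2[OF DERIV_isCont[OF m(1)] D2[OF p(1)]] isCont_o2[OF DERIV_isCont[OF m(2)] D2[OF p(2)]])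
qed

lemma W_0: "W p 0 = 0"
  by (simp add: W_def)

lemma W_pos: "y \<noteq> 0 \<Longrightarrow> \<bar>y\<bar> < p \<Longrightarrow> 0 < W p y"
  using F_strictly_concave[of y p] by (simp add: W_def)

lemma W_nonneg: "\<bar>y\<bar> < p \<Longrightarrow> 0 \<le> W p y"
  using W_pos[of y p] W_0[of p] by (cases "y = 0") auto

lemma continuous_W: "continuous_on A (W p)"
  unfolding W_def
  by (intro continuous_intros continuous_on_compose2[OF continuous_F]) auto

text \<open>\<open>W\<close> is a sum of two differences against \<open>F p\<close>, each with
  increment \<open>y\<close>, so Hoelder continuity bounds it without an additive constant.\<close>

lemma W_growth: "\<exists>C\<ge>0. \<forall>y. \<bar>W p y\<bar> \<le> C * \<bar>y\<bar> powr s"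
proof -
  obtain C where C: "\<And>t u. \<bar>F t - F u\<bar> \<le> C * \<bar>t - u\<bar> powr s" using F_holder by blast
  have "0 \<le> C" using C[of 1 0] by auto
  moreover have "\<bar>W p y\<bar> \<le> 2 * C * \<bar>y\<bar> powr s" for y
    using C[of p "p - y"] C[of p "p + y"] by (simp add: W_def)
  ultimately show ?thesis by (intro exI[of _ "2 * C"]) auto
qed

text \<open>Evenness of \<open>F\<close> rewrites the two terms as profiles singular at the
  hyperplanes of height \<open>p\<close> and \<open>- p\<close>, both missed by \<open>x\<close>.
  The value obtained is the second derivative of \<open>W p\<close> at \<open>x \<bullet> b\<close>,
  which is what cancels against the Laplacian.\<close>

lemma has_frac_lap_W:
  fixes b x :: "'a::euclidean_space"
  assumes b: "b \<in> Basis" and x: "\<bar>x \<bullet> b\<bar> < p"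
  shows "has_frac_lap s (\<lambda>y. W p (y \<bullet> b)) x (D 2 (p - x \<bullet> b) + D 2 (p + x \<bullet> b))"
proof -
  have "has_frac_lap s (\<lambda>y. 2 * F p + - F (y \<bullet> b - p) + - F (y \<bullet> b - (- p))) x
      (0 + - (- D 2 \<bar>x \<bullet> b - p\<bar>) + - (- D 2 \<bar>x \<bullet> b - (- p)\<bar>))"
    using x by (intro has_frac_lap_add has_frac_lap_const has_frac_lap_uminus has_frac_lap_F b) auto
  moreover have "2 * F p + - F (y \<bullet> b - p) + - F (y \<bullet> b - (- p)) = W p (y \<bullet> b)" for y
    using F_minus[of "p - y \<bullet> b"] by (simp add: W_def add.commute)
  moreover have "0 + - (- D 2 \<bar>x \<bullet> b - p\<bar>) + - (- D 2 \<bar>x \<bullet> b - (- p)\<bar>) = D 2 (p - x \<bullet> b) + D 2 (p + x \<bullet> b)"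
    using x by (simp add: abs_of_pos abs_of_neg add.commute)
  ultimately show ?thesis by simp
qed

lemma exists_mixed_harmonic_interior_minimum:
  assumes r: "1 < r"
  shows "\<exists>v :: 'a::euclidean_space \<Rightarrow> real.
           C2_on (ball 0 1) v \<and>
           continuous_on UNIV v \<and>
           integrable lborel (\<lambda>x. \<bar>v x\<bar> / (1 + norm x powr (real DIM('a) + 2 * s))) \<and>
           (\<forall>x\<in>ball 0 1. has_mixed_op s v x 0) \<and>
           (INF x\<in>ball 0 r - ball 0 1. v x) > 0 \<and>
           (\<exists>x0\<in>ball 0 1. (\<forall>x\<in>ball 0 1. v x0 \<le> v x) \<and> v x0 < 0)"
proof -
  \<comment> \<open>Any value above \<open>r\<close> would do: the closed ball of radius
    \<open>r\<close> then lies in the open cube where \<open>W p\<close> is nonnegative and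
    smooth.\<close>
  define p where "p = r + 1"
  define w where "w x = (\<Sum>b\<in>Basis. W p (x \<bullet> b))" for x :: 'a
  have coord: "\<bar>x \<bullet> b\<bar> < p" if "norm x \<le> r" "b \<in> Basis" for x b :: 'a
    using Basis_le_norm[OF that(2), of x] that(1) by (simp add: p_def)
  have w_nonneg: "0 \<le> w x" if "norm x \<le> r" for x
    unfolding w_def using coord[OF that] by (intro sum_nonneg W_nonneg) auto
  have w_pos: "0 < w x" if "norm x \<le> r" "x \<noteq> 0" for x
  proof -
    obtain b where b: "b \<in> Basis" "x \<bullet> b \<noteq> 0"
      using \<open>x \<noteq> 0\<close> euclidean_all_zero_iff[of x] by blast
    have "0 < W p (x \<bullet> b)" using b coord[OF that(1)] by (intro W_pos) auto
    then show ?thesis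
      unfolding w_def using b coord[OF that(1)] by (intro sum_pos2[of _ b] W_nonneg) auto
  qed
  have cont_w: "continuous_on A w" for A
    unfolding w_def by (intro continuous_on_sum continuous_on_compose2[OF continuous_W[of UNIV]] continuous_intros) auto
  obtain d :: 'a where "d \<in> Basis" using nonempty_Basis by blast
  then have d: "norm d = 1" by simp
  \<comment> \<open>A unit vector lies in the annulus because \<open>1 < r\<close>; nonemptiness is
    required both for an attained minimum and for the infimum bound.\<close>
  have "d \<in> ball 0 r - ball 0 1" using r d by simp
  then have annulus: "ball 0 r - ball (0::'a) 1 \<noteq> {}" by blast
  then have cannulus: "cball 0 r - ball (0::'a) 1 \<noteq> {}" using ball_subset_cball by blast
  \<comment> \<open>The annulus is enlarged by its outer sphere to make it compact. The minimum is
    then attained, and pointwise positivity of \<open>w\<close> away from the origin becomes the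
    uniform bound \<open>\<delta>\<close>.\<close>
  have "compact (cball 0 r - ball (0::'a) 1)"
    by (intro compact_diff) auto
  from continuous_attains_inf[OF this cannulus cont_w] obtain x1
    where x1: "x1 \<in> cball 0 r - ball 0 1" "\<And>y. y \<in> cball 0 r - ball 0 1 \<Longrightarrow> w x1 \<le> w y" by blast
  define \<delta> where "\<delta> = w x1"
  have \<delta>: "0 < \<delta>" unfolding \<delta>_def using x1(1) by (intro w_pos) auto
  define v where "v x = w x + (- \<delta> / 2)" for x
  interpret V: separable "ball (0::'a) 1" "W p" "\<lambda>y. D 1 (p - y) - D 1 (p + y)"
    "\<lambda>y. D 2 (p - y) + D 2 (p + y)" "- \<delta> / 2"
  proof
    fix x b :: 'a assume "x \<in> ball 0 1" "b \<in> Basis"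
    then have "\<bar>x \<bullet> b\<bar> < p" using r by (intro coord) auto
    from W_derivatives[OF this]
    show "(W p has_real_derivative D 1 (p - x \<bullet> b) - D 1 (p + x \<bullet> b)) (at (x \<bullet> b))"
      "((\<lambda>y. D 1 (p - y) - D 1 (p + y)) has_real_derivative D 2 (p - x \<bullet> b) + D 2 (p + x \<bullet> b)) (at (x \<bullet> b))"
      "isCont (\<lambda>y. D 2 (p - y) + D 2 (p + y)) (x \<bullet> b)" .
  qed simp
  have vV: "v = V.v" by (rule ext) (simp only: v_def w_def V.v_def)
  show ?thesis
  proof (intro exI[of _ v] conjI ballI)
    show "C2_on (ball 0 1) v" unfolding vV by (rule V.C2_on_v)
    show cont_v: "continuous_on UNIV v" unfolding v_def by (intro continuous_intros cont_w)
    show "has_mixed_op s v x 0" if x: "x \<in> ball 0 1" for x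
    proof -
      have "\<bar>x \<bullet> b\<bar> < p" if "b \<in> Basis" for b using x r that by (intro coord) auto
      then have "has_frac_lap s v x ((\<Sum>b\<in>Basis. D 2 (p - x \<bullet> b) + D 2 (p + x \<bullet> b)) + 0)"
        unfolding v_def w_def
        by (intro has_frac_lap_add has_frac_lap_const has_frac_lap_sum has_frac_lap_W) auto
      then show ?thesis
        unfolding has_mixed_op_def vV V.laplacian_v[OF x] by (intro exI conjI) auto
    qed
    show "0 < (INF x\<in>ball 0 r - ball 0 1. v x)"
    proof (rule less_le_trans[of _ "\<delta> / 2"])
      show "\<delta> / 2 \<le> (INF x\<in>ball 0 r - ball 0 1. v x)"
      proof (rule cINF_greatest)
        show "ball 0 r - ball (0::'a) 1 \<noteq> {}" by (rule annulus)
        show "\<delta> / 2 \<le> v x" if "x \<in> ball 0 r - ball 0 1" for x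
          using x1(2)[of x] that by (simp add: v_def \<delta>_def)
      qed
    qed (use \<delta> in simp)
    show "\<exists>x0\<in>ball 0 1. (\<forall>x\<in>ball 0 1. v x0 \<le> v x) \<and> v x0 < 0"
    proof (intro bexI[of _ 0] conjI ballI)
      have "w 0 = 0" by (simp add: w_def W_0)
      then show "v 0 < 0" using \<delta> by (simp add: v_def)
      show "v 0 \<le> v x" if "x \<in> ball 0 1" for x
        using \<open>w 0 = 0\<close> w_nonneg[of x] that r by (simp add: v_def)
    qed simp
    obtain C where C: "0 \<le> C" "\<And>y. \<bar>W p y\<bar> \<le> C * \<bar>y\<bar> powr s" using W_growth by blast
    have w_le: "\<bar>w x\<bar> \<le> real DIM('a) * C * norm x powr s" for x
    proof -
      have "\<bar>w x\<bar> \<le> (\<Sum>b\<in>Basis. \<bar>W p (x \<bullet> b)\<bar>)" unfolding w_def by (rule sum_abs)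
      also have "\<dots> \<le> (\<Sum>b\<in>(Basis::'a set). C * norm x powr s)"
      proof (rule sum_mono)
        fix b :: 'a assume "b \<in> Basis"
        then have "\<bar>x \<bullet> b\<bar> powr s \<le> norm x powr s"
          using s by (intro powr_mono2 Basis_le_norm) auto
        then show "\<bar>W p (x \<bullet> b)\<bar> \<le> C * norm x powr s"
          using order_trans[OF C(2) mult_left_mono[OF _ C(1)]] by blast
      qed
      finally show ?thesis by simp
    qed
    \<comment> \<open>One constant for both regimes: inside the unit ball
      \<open>norm x powr s \<le> 1\<close>, and outside it the additive \<open>\<delta> / 2\<close>
      is absorbed because \<open>norm x powr s \<ge> 1\<close>.\<close>
    define E where "E = real DIM('a) * C + \<delta> / 2"
    have v_le: "\<bar>v x\<bar> \<le> real DIM('a) * C * norm x powr s + \<delta> / 2" for x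
      using w_le[of x] \<delta> by (simp add: v_def)
    let ?n = "real DIM('a) + 2 * s"
    show "integrable lborel (\<lambda>x. \<bar>v x\<bar> / (1 + norm x powr ?n))"
    proof (rule integrable_norm_powr_bounds[where C = E and \<alpha> = 0 and \<beta> = "s - ?n"])
      have [measurable]: "v \<in> borel_measurable borel"
        using cont_v by (rule borel_measurable_continuous_onI)
      show "(\<lambda>x. \<bar>v x\<bar> / (1 + norm x powr ?n)) \<in> borel_measurable borel" by measurable
      show "\<bar>\<bar>v x\<bar> / (1 + norm x powr ?n)\<bar> \<le> E * norm x powr 0" if "x \<noteq> 0" "norm x \<le> 1" for x
      proof -
        have "norm x powr s \<le> 1" using that s by (intro powr_le1) auto
        then have "real DIM('a) * C * norm x powr s \<le> real DIM('a) * C * 1"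
          using C by (intro mult_left_mono) auto
        then have "\<bar>v x\<bar> \<le> E" using v_le[of x] unfolding E_def mult_1_right by linarith
        moreover have "\<bar>v x\<bar> / (1 + norm x powr ?n) \<le> \<bar>v x\<bar> / 1"
          by (intro divide_left_mono) (auto simp: add_pos_nonneg)
        ultimately show ?thesis using that by (simp add: add_nonneg_nonneg)
      qed
      show "\<bar>\<bar>v x\<bar> / (1 + norm x powr ?n)\<bar> \<le> E * norm x powr (s - ?n)" if "1 \<le> norm x" for x
      proof -
        have "1 \<le> norm x powr s" using that s by (intro ge_one_powr_ge_zero) auto
        then have "\<delta> / 2 * 1 \<le> \<delta> / 2 * norm x powr s" using \<delta> by (intro mult_left_mono) auto
        then have "\<bar>v x\<bar> \<le> E * norm x powr s" using v_le[of x] by (simp add: E_def distrib_right)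
        then have "\<bar>v x\<bar> / (1 + norm x powr ?n) \<le> E * norm x powr s / norm x powr ?n"
          using that by (intro frac_le) auto
        then show ?thesis by (simp only: powr_diff times_divide_eq_right) (simp add: add_nonneg_nonneg)
      qed
    qed (use s in auto)
  qed
qed

end

theorem mainTheorem7:
  fixes s r :: real
  assumes "0 < s" and "s < 1" and "1 < r"
  shows "\<exists>v :: real ^ 'n \<Rightarrow> real.
           C2_on (ball 0 1) v \<and>
           continuous_on UNIV v \<and>
           integrable lborel (\<lambda>x. \<bar>v x\<bar> / (1 + norm x powr (real CARD('n) + 2 * s))) \<and>
           (\<forall>x\<in>ball 0 1. has_mixed_op s v x 0) \<and>
           (INF x\<in>ball 0 r - ball 0 1. v x) > 0 \<and>
           (\<exists>x0\<in>ball 0 1. (\<forall>x\<in>ball 0 1. v x0 \<le> v x) \<and> v x0 < 0)"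
proof -
  interpret frac_order s
    using assms by unfold_locales
  show ?thesis
    using exists_mixed_harmonic_interior_minimum[OF \<open>1 < r\<close>, where 'a = "real ^ 'n"] by simp
qed

end
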